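(* Let $\varphi:\mathbb{D}\to\mathbb{D}$ be a linear fractional non-automorphic parabolic map. Then $C_\varphi\in\mathcal{L}(H^p)$ does not commute with any non-trivial idempotent for all $1\le p<\infty$.
   Context: $\mathbb{D}$ is the open unit disc of $\mathbb{C}$ and $\mathbb{T}$ the unit circle. For $1\le p<\infty$, $H^p$ is the Banach space of holomorphic $f:\mathbb{D}\to\mathbb{C}$ with $\|f\|_{H^p}=\left(\sup_{0<r<1}\int_0^{2\pi}|f(re^{i\theta})|^p\,d\theta\right)^{1/p}<\infty$. For holomorphic $\varphi:\mathbb{D}\to\mathbb{D}$, $C_\varphi f=f\circ\varphi$, a bounded operator on $H^p$; $\mathcal{L}(H^p)$ is the algebra of bounded linear operators on $H^p$. A non-trivial idempotent is $J\in\mathcal{L}(H^p)$ with $J^2=J$, $J\ne 0$, $J\neq \mathrm{Id}$. A linear fractional self-map $\varphi$ of $\mathbb{D}$ is parabolic if, as a Möbius map of the Riemann sphere, it has exactly one fixed point (which necessarily lies on $\mathbb{T}$); it is non-automorphic if it does not map $\mathbb{D}$ onto $\mathbb{D}$. *)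

theory Defs
  imports "HOL-Complex_Analysis.Complex_Analysis"
begin

abbreviation unit_disc :: "complex set" ("\<D>") where
  "\<D> \<equiv> ball 0 1"

section \<open>Hardy spaces\<close>

definition hardy_integral :: "real \<Rightarrow> (complex \<Rightarrow> complex) \<Rightarrow> real \<Rightarrow> real" where
  "hardy_integral p f r = integral {0..2 * pi} (\<lambda>\<theta>. cmod (f (of_real r * cis \<theta>)) powr p)"

text \<open>
  A function on the disc is represented by its extension by \<open>0\<close> to the whole plane, so that
  equality of elements of the space is equality of HOL functions.
\<close>

definition hardy_space :: "real \<Rightarrow> (complex \<Rightarrow> complex) set" where
  "hardy_space p = {f. f holomorphic_on \<D> \<and> (\<forall>z. z \<notin> \<D> \<longrightarrow> f z = 0) \<and>
     bdd_above (hardy_integral p f ` {0<..<1})}"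

text \<open>The real-valued supremum is meaningful only on \<^term>\<open>hardy_space p\<close>, where it is finite.\<close>

definition hardy_norm :: "real \<Rightarrow> (complex \<Rightarrow> complex) \<Rightarrow> real" where
  "hardy_norm p f = (SUP r\<in>{0<..<1}. hardy_integral p f r) powr (1 / p)"

section \<open>Bounded operators\<close>

text \<open>
  An operator is a HOL function of which only the values on \<^term>\<open>hardy_space p\<close> matter: all
  statements about operators below, including equalities, are relative to that set.
\<close>

definition hardy_ops :: "real \<Rightarrow> ((complex \<Rightarrow> complex) \<Rightarrow> complex \<Rightarrow> complex) set" where
  "hardy_ops p = {A.
     (\<forall>f\<in>hardy_space p. A f \<in> hardy_space p) \<and>
     (\<forall>f\<in>hardy_space p. \<forall>g\<in>hardy_space p. A (\<lambda>z. f z + g z) = (\<lambda>z. A f z + A g z)) \<and>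
     (\<forall>f\<in>hardy_space p. \<forall>c. A (\<lambda>z. c * f z) = (\<lambda>z. c * A f z)) \<and>
     (\<exists>K. \<forall>f\<in>hardy_space p. hardy_norm p (A f) \<le> K * hardy_norm p f)}"

definition nontrivial_idempotent ::
    "real \<Rightarrow> ((complex \<Rightarrow> complex) \<Rightarrow> complex \<Rightarrow> complex) \<Rightarrow> bool" where
  "nontrivial_idempotent p J \<longleftrightarrow> J \<in> hardy_ops p \<and>
     (\<forall>f\<in>hardy_space p. J (J f) = J f) \<and>
     \<not> (\<forall>f\<in>hardy_space p. J f = (\<lambda>z. 0)) \<and>
     \<not> (\<forall>f\<in>hardy_space p. J f = f)"

definition ops_commute :: "real \<Rightarrow> ((complex \<Rightarrow> complex) \<Rightarrow> complex \<Rightarrow> complex) \<Rightarrow>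
    ((complex \<Rightarrow> complex) \<Rightarrow> complex \<Rightarrow> complex) \<Rightarrow> bool" where
  "ops_commute p A B \<longleftrightarrow> (\<forall>f\<in>hardy_space p. A (B f) = B (A f))"

definition comp_op :: "(complex \<Rightarrow> complex) \<Rightarrow> (complex \<Rightarrow> complex) \<Rightarrow> complex \<Rightarrow> complex" where
  "comp_op \<phi> f = (\<lambda>z. if z \<in> \<D> then f (\<phi> z) else 0)"

section \<open>Linear fractional maps\<close>

text \<open>
  The Riemann sphere is \<^typ>\<open>complex option\<close>, with \<^term>\<open>None\<close> as the point at infinity.
\<close>

definition moebius ::
    "complex \<Rightarrow> complex \<Rightarrow> complex \<Rightarrow> complex \<Rightarrow> complex option \<Rightarrow> complex option" where
  "moebius a b c d w = (case w of
     None \<Rightarrow> if c = 0 then None else Some (a / c)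
   | Some z \<Rightarrow> if c * z + d = 0 then None else Some ((a * z + b) / (c * z + d)))"

definition moebius_map :: "(complex option \<Rightarrow> complex option) \<Rightarrow> bool" where
  "moebius_map M \<longleftrightarrow> (\<exists>a b c d. a * d - b * c \<noteq> 0 \<and> M = moebius a b c d)"

text \<open>The Moebius map extending \<open>\<phi>\<close> is unique, being determined by its values on the disc.\<close>

definition parabolic_linear_fractional :: "(complex \<Rightarrow> complex) \<Rightarrow> bool" where
  "parabolic_linear_fractional \<phi> \<longleftrightarrow>
     (\<exists>M. moebius_map M \<and> (\<forall>z\<in>\<D>. M (Some z) = Some (\<phi> z)) \<and> (\<exists>!w. M w = w))"

end

theory Submission
  imports Defs
begin

text \<open>
  The Cayley transform at the fixed point \<open>\<alpha>\<close> of \<open>\<phi>\<close> identifies the disc with the right half-plane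
  and \<open>\<phi>\<close> with a translation \<open>w \<mapsto> w + a\<close>, where \<open>Re a > 0\<close> because \<open>\<phi>\<close> is not onto. The bounded
  functions \<open>exp (- s w)\<close> with \<open>s \<ge> 0\<close> are eigenfunctions of \<open>C\<^sub>\<phi>\<close>, with eigenvalue \<open>exp (- s a)\<close>. An
  operator \<open>J\<close> that commutes with \<open>C\<^sub>\<phi>\<close> preserves the eigenspaces, and these eigenspaces are lines
  (lemma \<open>eigenfunction\<close>): divided by \<open>exp (- s w)\<close>, an eigenfunction is \<open>a\<close>-periodic, hence extends
  to an entire function of polynomial growth, hence is constant. So \<open>J\<close> multiplies \<open>exp (- s w)\<close> by a
  number \<open>b s\<close>. If \<open>J\<close> is idempotent, then \<open>b s\<close> is \<open>0\<close> or \<open>1\<close>; as \<open>exp (- s w)\<close> depends continuously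
  on \<open>s\<close> in the Hardy norm, \<open>b\<close> is continuous on \<open>[0, \<infinity>)\<close>, hence constant, and \<open>J\<close> agrees with \<open>0\<close>
  or with the identity on all the eigenfunctions.

  It remains to see that an operator that acts on the functions \<open>exp (- s w)\<close> as a scalar \<open>c\<close> acts so
  on the whole space. Since \<open>(J f) \<circ> \<phi> = J (f \<circ> \<phi>)\<close> and the image of \<open>\<phi>\<close> is open, the identity theorem
  reduces this to functions of the form \<open>f \<circ> \<phi>\<close> (lemma \<open>scalar_action\<close>). These extend continuously to
  the closed disc without \<open>\<alpha>\<close> and grow at most like \<open>1 / (cmod (\<alpha> - z))\<^sup>2\<close> near \<open>\<alpha>\<close>. For such
  functions the integral means over all circles are controlled by the integral over the unit circle,
  so that dominated convergence there implies convergence in the Hardy norm (lemma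
  \<open>hardy_op_dominated_convergence\<close>). The approximation runs through Riemann sums of
  \<open>\<integral> exp (- s (1 + w)) ds = 1 / (1 + w)\<close>, which is a polynomial of degree one in \<open>z\<close>, then through polynomials, dilations of bounded functions, and
  products of \<open>f \<circ> \<phi>\<close> with factors that vanish at \<open>\<alpha>\<close>.

  Both this control and the boundedness of \<open>C\<^sub>\<phi>\<close> come from the inequality
  \<open>|F z|\<^sup>p \<le> \<integral> P(z, \<zeta>) |F \<zeta>|\<^sup>p\<close> for the normalised Poisson kernel \<open>P\<close> and from the mean value property
  of \<open>z \<mapsto> P(\<psi> z, \<zeta>)\<close> for holomorphic self-maps \<open>\<psi>\<close> (lemma \<open>littlewood_subordination\<close>). As
  \<open>p \<ge> 1\<close>, that inequality is Jensen's inequality for the Poisson formula.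
\<close>

section \<open>The Poisson inequality for continuous boundary values\<close>

definition poisson :: "complex \<Rightarrow> complex \<Rightarrow> real" where
  "poisson z \<zeta> = (1 - (cmod z)\<^sup>2) / (cmod (\<zeta> - z))\<^sup>2"

lemma poisson_eq_Re:
  assumes "cmod \<zeta> = 1"
  shows "poisson z \<zeta> = Re ((\<zeta> + z) / (\<zeta> - z))"
proof -
  have "(\<zeta> + z) / (\<zeta> - z) = (\<zeta> + z) * cnj (\<zeta> - z) / of_real ((cmod (\<zeta> - z))\<^sup>2)"
    by (subst complex_div_cnj) simp
  then have "Re ((\<zeta> + z) / (\<zeta> - z)) = Re ((\<zeta> + z) * cnj (\<zeta> - z)) / (cmod (\<zeta> - z))\<^sup>2"
    by (simp only: Re_divide_of_real)
  also have "Re ((\<zeta> + z) * cnj (\<zeta> - z)) = (cmod \<zeta>)\<^sup>2 - (cmod z)\<^sup>2"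
    unfolding cmod_power2 by (simp add: algebra_simps power2_eq_square)
  finally show ?thesis
    using assms by (simp add: poisson_def)
qed

lemma poisson_nonneg: "cmod z \<le> 1 \<Longrightarrow> 0 \<le> poisson z \<zeta>"
  by (simp add: poisson_def power_le_one_iff)

lemma poisson_le:
  assumes "cmod z < 1" "cmod \<zeta> = 1"
  shows "poisson z \<zeta> \<le> 2 / (1 - cmod z)"
proof -
  have d: "1 - cmod z \<le> cmod (\<zeta> - z)"
    using norm_triangle_ineq2[of \<zeta> z] assms by simp
  have "poisson z \<zeta> \<le> (1 - (cmod z)\<^sup>2) / (1 - cmod z)\<^sup>2"
    unfolding poisson_def using assms d
    by (intro divide_left_mono power_mono mult_pos_pos zero_less_power)
       (auto simp: power_le_one_iff)
  also have "\<dots> = (1 + cmod z) / (1 - cmod z)"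
    using assms by (simp add: divide_simps power2_eq_square) (simp add: algebra_simps)
  also have "\<dots> \<le> 2 / (1 - cmod z)"
    using assms by (intro divide_right_mono) auto
  finally show ?thesis .
qed

lemma continuous_on_poisson_cis:
  assumes "z \<in> \<D>"
  shows "continuous_on A (\<lambda>t. poisson z (cis t))"
  unfolding poisson_def using assms by (intro continuous_intros) auto

text \<open>
  The Cauchy kernel becomes the Poisson kernel on the circle when \<open>F\<close> is multiplied by
  \<open>(1 - z * cnj z) / (1 - cnj z * u)\<close>, a function of \<open>u\<close> that is holomorphic near the closed disc and
  equals \<open>1\<close> at \<open>u = z\<close>.
\<close>
lemma poisson_formula:
  fixes F :: "complex \<Rightarrow> complex"
  assumes cont: "continuous_on (cball 0 1) F" and hol: "F holomorphic_on \<D>" and z: "z \<in> \<D>"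
  shows "((\<lambda>t. of_real (poisson z (cis t)) * F (cis t)) has_integral of_real (2 * pi) * F z) {0..2*pi}"
proof -
  define G where "G = (\<lambda>u. F u * ((1 - z * cnj z) / (1 - cnj z * u)))"
  have nz: "1 - cnj z * u \<noteq> 0" if "u \<in> cball 0 1" for u
  proof
    assume "1 - cnj z * u = 0"
    then have "cmod z * cmod u = 1"
      by (metis complex_mod_cnj eq_iff_diff_eq_0 norm_mult norm_one)
    moreover have "cmod z * cmod u \<le> cmod z * 1"
      using that by (intro mult_left_mono) auto
    ultimately show False using z by auto
  qed
  have Gz: "G z = F z"
    using nz[of z] z by (simp add: G_def mult.commute)
  have "((\<lambda>u. G u / (u - z)) has_contour_integral (2 * of_real pi * \<i> * G z)) (circlepath 0 1)"
  proof (rule Cauchy_integral_circlepath)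
    show "continuous_on (cball 0 1) G"
      unfolding G_def using nz by (intro continuous_intros cont) auto
    show "G holomorphic_on \<D>"
      unfolding G_def using nz by (intro holomorphic_intros hol) auto
    show "cmod (z - 0) < 1" using z by simp
  qed
  then have "((\<lambda>t. G (0 + of_real 1 * cis t) / (0 + of_real 1 * cis t - z) * of_real 1 * \<i> * cis t)
      has_integral (2 * of_real pi * \<i> * G z)) {0..2*pi}"
    unfolding circlepath_def by (subst (asm) has_contour_integral_part_circlepath_iff) auto
  then have "((\<lambda>t. (1/\<i>) * (G (cis t) / (cis t - z) * \<i> * cis t))
      has_integral ((1/\<i>) * (2 * of_real pi * \<i> * G z))) {0..2*pi}"
    by (intro has_integral_mult_right) simp
  moreover have "(1/\<i>) * (G (cis t) / (cis t - z) * \<i> * cis t)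
      = of_real (poisson z (cis t)) * F (cis t)" for t
  proof -
    let ?c = "cis t"
    have c: "?c * cnj ?c = 1"
      by (simp add: cis_cnj cis_mult)
    have ne: "?c - z \<noteq> 0" using z by auto
    have "1 - cnj z * ?c = ?c * cnj (?c - z)"
      using c by (simp add: algebra_simps)
    then have "(1/\<i>) * (G ?c / (?c - z) * \<i> * ?c)
        = F ?c * (1 - z * cnj z) / ((?c - z) * cnj (?c - z))"
      using ne by (simp add: G_def divide_simps) (simp add: algebra_simps)
    also have "\<dots> = of_real (poisson z ?c) * F ?c"
      unfolding poisson_def of_real_divide of_real_diff of_real_1 complex_norm_square
      by (simp add: mult.commute)
    finally show ?thesis .
  qed
  moreover have "(1/\<i>) * (2 * of_real pi * \<i> * G z) = of_real (2 * pi) * F z"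
    using Gz by (simp add: field_simps)
  ultimately show ?thesis
    by (simp only:)
qed

lemma poisson_integral_one:
  assumes "z \<in> \<D>"
  shows "((\<lambda>t. poisson z (cis t)) has_integral 2 * pi) {0..2*pi}"
proof -
  have "((\<lambda>t. of_real (poisson z (cis t)) * 1) has_integral complex_of_real (2 * pi) * 1) {0..2*pi}"
    by (rule poisson_formula[OF _ _ assms]) auto
  from has_integral_Re[OF this] show ?thesis by simp
qed

lemma integral_Re_circle:
  fixes F :: "complex \<Rightarrow> complex"
  assumes "F holomorphic_on \<D>" "0 < r" "r < 1"
  shows "((\<lambda>t. Re (F (of_real r * cis t))) has_integral 2 * pi * Re (F 0)) {0..2*pi}"
proof -
  have sub: "(\<lambda>z. of_real r * z) ` cball 0 1 \<subseteq> \<D>"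
    using assms by (auto simp: norm_mult) (smt (verit) mult_left_le norm_ge_zero)
  have "((\<lambda>t. of_real (poisson 0 (cis t)) * F (of_real r * cis t)) has_integral
      of_real (2 * pi) * F (of_real r * 0)) {0..2*pi}"
  proof (rule poisson_formula)
    show "continuous_on (cball 0 1) (\<lambda>z. F (of_real r * z))"
      by (rule continuous_on_compose2[OF holomorphic_on_imp_continuous_on[OF assms(1)] _ sub])
         (intro continuous_intros)
    show "(\<lambda>z. F (of_real r * z)) holomorphic_on \<D>"
      by (rule holomorphic_on_compose_gen[OF _ assms(1), unfolded o_def])
         (use sub in \<open>force intro!: holomorphic_intros\<close>)+
  qed auto
  from has_integral_Re[OF this] show ?thesis
    by (simp add: poisson_def)
qed

text \<open>
  Young's inequality for \<open>x\<close> and \<open>m powr (p - 1)\<close> with the exponents \<open>p\<close> and \<open>p / (p - 1)\<close>.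
  Integrating it against a probability density, with \<open>m\<close> a lower bound of the mean of \<open>x\<close>, gives
  Jensen's inequality.
\<close>
lemma powr_above_tangent:
  fixes x m p :: real
  assumes "0 \<le> x" "0 < m" "1 \<le> p"
  shows "m powr p + p * m powr (p - 1) * (x - m) \<le> x powr p"
proof (cases "x = 0 \<or> p = 1")
  case True
  then show ?thesis
  proof
    assume "x = 0"
    have "m powr p = m powr (p - 1) * m"
      using assms powr_add[of m "p - 1" 1] by simp
    moreover have "1 * (m powr (p-1) * m) \<le> p * (m powr (p-1) * m)"
      using assms by (intro mult_right_mono) auto
    ultimately show ?thesis using \<open>x = 0\<close> assms by (simp add: algebra_simps)
  qed (use assms in auto)
next
  case False
  then have p: "p > 1" and x: "x > 0" using assms by auto
  have q: "x * m powr (p - 1) \<le> x powr p / p + (m powr (p-1)) powr (p/(p-1)) / (p/(p-1))"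
    using p assms by (intro Youngs_inequality) (auto simp: field_simps)
  have "(m powr (p-1)) powr (p/(p-1)) = m powr p"
    using p by (simp add: powr_powr)
  then have "p * (x * m powr (p - 1)) \<le> x powr p + m powr p * (p - 1)"
    using q p by (simp add: field_simps)
  moreover have "m powr p = m powr (p - 1) * m"
    using assms powr_add[of m "p - 1" 1] by simp
  ultimately show ?thesis by (simp add: algebra_simps)
qed

text \<open>
  The Poisson formula bounds \<open>cmod (F z)\<close> by the Poisson mean of \<open>cmod (F \<zeta>)\<close>; the rest is Jensen's
  inequality, since the kernel has total mass \<open>2 * pi\<close>.
\<close>
lemma poisson_inequality:
  fixes F :: "complex \<Rightarrow> complex"
  assumes cont: "continuous_on (cball 0 1) F" and hol: "F holomorphic_on \<D>" and z: "z \<in> \<D>"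
    and p: "1 \<le> p"
  shows "2 * pi * cmod (F z) powr p
    \<le> integral {0..2*pi} (\<lambda>t. poisson z (cis t) * cmod (F (cis t)) powr p)"
proof -
  let ?m = "cmod (F z)" and ?P = "\<lambda>t. poisson z (cis t)" and ?g = "\<lambda>t. cmod (F (cis t))"
  have P0: "?P t \<ge> 0" for t using poisson_nonneg[of z] z by simp
  have cF: "continuous_on {0..2*pi} (\<lambda>t. F (cis t))"
    by (rule continuous_on_compose2[OF cont]) (auto intro!: continuous_intros)
  have cP: "continuous_on {0..2*pi} ?P" by (rule continuous_on_poisson_cis[OF z])
  have cPg: "continuous_on {0..2*pi} (\<lambda>t. ?P t * ?g t)"
    by (intro continuous_intros cP cF)
  have cPgp: "continuous_on {0..2*pi} (\<lambda>t. ?P t * ?g t powr p)"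
    using p by (intro continuous_intros cP cF continuous_on_powr') auto
  show ?thesis
  proof (cases "?m = 0")
    case True
    have "0 \<le> integral {0..2*pi} (\<lambda>t. ?P t * ?g t powr p)"
      using P0 by (intro integral_nonneg integrable_continuous_interval[OF cPgp]) auto
    then show ?thesis using True by simp
  next
    case False
    then have m: "?m > 0" by simp
    have mean: "2 * pi * ?m \<le> integral {0..2*pi} (\<lambda>t. ?P t * ?g t)"
    proof -
      have "cmod (integral {0..2*pi} (\<lambda>t. of_real (?P t) * F (cis t)))
          \<le> integral {0..2*pi} (\<lambda>t. ?P t * ?g t)"
        using P0 by (intro integral_norm_bound_integral integrable_continuous_interval
            continuous_intros cP cF) (auto simp: norm_mult)
      then show ?thesis
        using integral_unique[OF poisson_formula[OF cont hol z]] by (simp add: norm_mult)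
    qed
    let ?k = "p * ?m powr (p - 1)"
    have "((\<lambda>t. (?m powr p - ?k * ?m) * ?P t + ?k * (?P t * ?g t)) has_integral
        (?m powr p - ?k * ?m) * (2*pi) + ?k * integral {0..2*pi} (\<lambda>t. ?P t * ?g t)) {0..2*pi}"
      by (intro has_integral_add has_integral_mult_right poisson_integral_one z
          integrable_integral integrable_continuous_interval cPg)
    then have "(?m powr p - ?k * ?m) * (2*pi) + ?k * integral {0..2*pi} (\<lambda>t. ?P t * ?g t)
        \<le> integral {0..2*pi} (\<lambda>t. ?P t * ?g t powr p)"
    proof (rule has_integral_le[OF _ integrable_integral[OF integrable_continuous_interval[OF cPgp]]])
      fix t
      have "?P t * (?m powr p + ?k * (?g t - ?m)) \<le> ?P t * ?g t powr p"
        by (intro mult_left_mono powr_above_tangent m p P0) auto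
      then show "(?m powr p - ?k * ?m) * ?P t + ?k * (?P t * ?g t) \<le> ?P t * ?g t powr p"
        by (simp add: algebra_simps)
    qed
    moreover have "?k * (2 * pi * ?m) \<le> ?k * integral {0..2*pi} (\<lambda>t. ?P t * ?g t)"
      using p by (intro mult_left_mono mean) auto
    ultimately show ?thesis by (simp add: algebra_simps)
  qed
qed

section \<open>The circle with one point removed\<close>

locale punctured_circle =
  fixes \<alpha> :: complex and p :: real
  assumes norm_\<alpha>: "cmod \<alpha> = 1" and p: "1 \<le> p"
begin

text \<open>
  The measure \<open>circ\<close> lives on the angles of points other than \<open>\<alpha>\<close>, so that functions with a
  singularity at \<open>\<alpha>\<close> are continuous, and hence measurable, on the whole measure space. Only finitely
  many angles are lost.
\<close>
definition punct :: "real set" where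
  "punct = {t \<in> {0..2*pi}. cis t \<noteq> \<alpha>}"

definition circ :: "real measure" where
  "circ = restrict_space lborel punct"

lemma punct_borel: "punct \<in> sets lborel"
proof -
  have "punct = {0..2*pi} \<inter> (- {t. cis t = \<alpha>})"
    by (auto simp: punct_def)
  moreover have "closed {t. cis t = \<alpha>}"
    by (intro closed_Collect_eq continuous_intros)
  ultimately show ?thesis
    by (simp add: borel_closed)
qed

lemma space_circ: "space circ = punct"
  by (simp add: circ_def space_restrict_space)

lemma finite_not_punct: "finite ({0..2*pi} - punct)"
proof -
  have "{0..2*pi} - punct \<subseteq> {Arg2pi \<alpha>, 2*pi}"
  proof
    fix t assume "t \<in> {0..2*pi} - punct"
    then have t: "0 \<le> t" "t \<le> 2 * pi" "cis t = \<alpha>" by (auto simp: punct_def)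
    show "t \<in> {Arg2pi \<alpha>, 2*pi}"
    proof (cases "t = 2 * pi")
      case False
      then have "Arg2pi \<alpha> = t"
        using t by (intro Arg2pi_unique[of 1]) (auto simp: cis_conv_exp)
      then show ?thesis by simp
    qed simp
  qed
  then show ?thesis by (rule finite_subset) simp
qed

lemma measurable_circ:
  fixes f :: "real \<Rightarrow> 'a::topological_space"
  assumes "continuous_on punct f"
  shows "f \<in> borel_measurable circ"
proof -
  have "f \<in> borel_measurable (restrict_space borel punct)"
    by (rule borel_measurable_continuous_on_restrict[OF assms])
  then show ?thesis
    unfolding circ_def by (simp cong: measurable_cong_sets sets_restrict_space_cong)
qed

lemma measurable_circ_boundary:
  fixes f :: "complex \<Rightarrow> 'a::topological_space"
  assumes "continuous_on (cball 0 1 - {\<alpha>}) f"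
  shows "(\<lambda>t. f (cis t)) \<in> borel_measurable circ"
  by (intro measurable_circ continuous_on_compose2[OF assms])
     (auto simp: punct_def intro!: continuous_intros)

lemma nn_integral_circ:
  assumes "continuous_on {0..2*pi} f" "\<And>t. t \<in> {0..2*pi} \<Longrightarrow> 0 \<le> f t"
  shows "(\<integral>\<^sup>+t. ennreal (f t) \<partial>circ) = ennreal (integral {0..2*pi} f)"
proof -
  have "(\<integral>\<^sup>+t. ennreal (f t) \<partial>circ) = (\<integral>\<^sup>+t. ennreal (f t) * indicator punct t \<partial>lborel)"
    unfolding circ_def using punct_borel by (subst nn_integral_restrict_space) auto
  also have "\<dots> = (\<integral>\<^sup>+t. ennreal (f t) * indicator {0..2*pi} t \<partial>lborel)"
  proof (rule nn_integral_cong_AE)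
    have "{0..2*pi} - punct \<in> null_sets lborel"
      by (rule finite_imp_null_set_lborel[OF finite_not_punct])
    then show "AE t in lborel. ennreal (f t) * indicator punct t
        = ennreal (f t) * indicator {0..2*pi} t"
      by (rule AE_I') (auto simp: indicator_def punct_def)
  qed
  also have "\<dots> = ennreal (integral {0..2*pi} f)"
    by (intro nn_integral_has_integral_lebesgue' assms integrable_integral
        integrable_continuous_interval)
  finally show ?thesis .
qed

lemma sigma_finite_circ: "sigma_finite_measure circ"
  unfolding circ_def
  by (intro sigma_finite_measure_restrict_space punct_borel) standard

lemma nn_integral_circ_const: "(\<integral>\<^sup>+t. ennreal c \<partial>circ) < \<infinity>"
proof (cases "c \<ge> 0")
  case True
  then show ?thesis by (subst nn_integral_circ) auto
qed (simp add: ennreal_neg)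

lemma pow_mean_circ:
  fixes f :: "complex \<Rightarrow> complex"
  assumes "continuous_on \<D> f" "0 \<le> r" "r < 1"
  shows "(\<integral>\<^sup>+t. ennreal (cmod (f (of_real r * cis t)) powr p) \<partial>circ) = ennreal (hardy_integral p f r)"
  unfolding hardy_integral_def using p assms
  by (intro nn_integral_circ continuous_on_powr' continuous_on_norm continuous_on_compose2[OF assms(1)])
     (auto simp: norm_mult intro!: continuous_intros)

text \<open>
  A form of subharmonicity of \<open>\<lambda>z. cmod (g z) powr p\<close> up to the boundary that makes sense for
  functions with a singularity at \<open>\<alpha>\<close>.
\<close>
definition poisson_dominated :: "(complex \<Rightarrow> complex) \<Rightarrow> bool" where
  "poisson_dominated g \<longleftrightarrow> (\<lambda>t. g (cis t)) \<in> borel_measurable circ \<and>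
     (\<forall>z\<in>\<D>. ennreal (cmod (g z) powr p)
        \<le> (\<integral>\<^sup>+t. ennreal (poisson z (cis t) / (2*pi)) * ennreal (cmod (g (cis t)) powr p) \<partial>circ))"

lemma poisson_dominated_continuous:
  assumes cont: "continuous_on (cball 0 1) g" and hol: "g holomorphic_on \<D>"
  shows "poisson_dominated g"
  unfolding poisson_dominated_def
proof (intro conjI ballI)
  show "(\<lambda>t. g (cis t)) \<in> borel_measurable circ"
    by (intro measurable_circ_boundary continuous_on_subset[OF cont]) auto
next
  fix z assume z: "z \<in> \<D>"
  have cg: "continuous_on {0..2*pi} (\<lambda>t. g (cis t))"
    by (rule continuous_on_compose2[OF cont]) (auto intro!: continuous_intros)
  have P0: "poisson z (cis t) \<ge> 0" for t using poisson_nonneg[of z] z by simp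
  let ?f = "\<lambda>t. poisson z (cis t) / (2*pi) * cmod (g (cis t)) powr p"
  have "cmod (g z) powr p \<le> integral {0..2*pi} (\<lambda>t. poisson z (cis t) * cmod (g (cis t)) powr p) / (2*pi)"
    using poisson_inequality[OF cont hol z p] by (simp add: field_simps)
  also have "\<dots> = integral {0..2*pi} ?f"
    by (simp flip: integral_divide)
  finally have "ennreal (cmod (g z) powr p) \<le> ennreal (integral {0..2*pi} ?f)"
    by (rule ennreal_leI)
  also have "\<dots> = (\<integral>\<^sup>+t. ennreal (?f t) \<partial>circ)"
    using p P0
    by (intro nn_integral_circ[symmetric] continuous_intros continuous_on_poisson_cis z cg
        continuous_on_powr') auto
  also have "\<dots> = (\<integral>\<^sup>+t. ennreal (poisson z (cis t) / (2*pi)) * ennreal (cmod (g (cis t)) powr p) \<partial>circ)"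
    using P0 by (intro nn_integral_cong ennreal_mult) auto
  finally show "ennreal (cmod (g z) powr p) \<le> \<dots>" .
qed

text \<open>
  Insert the Poisson bound at \<open>\<psi> (r * cis t)\<close> and exchange the integrals. In the variable \<open>z\<close>, the
  kernel \<open>poisson (\<psi> z) \<zeta>\<close> is the real part of a holomorphic function, so its mean over a circle is its
  value at the centre, which is at most \<open>2 / (1 - cmod (\<psi> 0))\<close>.
\<close>
lemma littlewood_subordination:
  assumes g: "poisson_dominated g"
    and \<psi>: "\<psi> holomorphic_on \<D>" "\<psi> ` \<D> \<subseteq> \<D>" and r: "0 < r" "r < 1"
  shows "(\<integral>\<^sup>+t. ennreal (cmod (g (\<psi> (of_real r * cis t))) powr p) \<partial>circ)
    \<le> ennreal (2 / (1 - cmod (\<psi> 0))) * (\<integral>\<^sup>+t. ennreal (cmod (g (cis t)) powr p) \<partial>circ)"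
proof -
  let ?u = "\<lambda>t. \<psi> (of_real r * cis t)"
  let ?q = "\<lambda>s. ennreal (cmod (g (cis s)) powr p)"
  have rD: "of_real r * cis t \<in> \<D>" for t using r by (simp add: norm_mult)
  then have uD: "?u t \<in> \<D>" for t using \<psi>(2) by blast
  have "continuous_on punct ?u"
    by (intro continuous_on_compose2[OF holomorphic_on_imp_continuous_on[OF \<psi>(1)]])
       (use rD in \<open>auto intro!: continuous_intros\<close>)
  then have [measurable]: "?u \<in> borel_measurable circ" by (rule measurable_circ)
  have [measurable]: "cis \<in> borel_measurable circ"
    by (intro measurable_circ continuous_intros)
  have [measurable]: "(\<lambda>t. g (cis t)) \<in> borel_measurable circ"
    using g by (simp add: poisson_dominated_def)
  have P0: "poisson (?u t) s \<ge> 0" for t s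
    using poisson_nonneg[of "?u t"] uD[of t] by simp
  interpret sigma_finite_measure circ by (rule sigma_finite_circ)
  interpret P: pair_sigma_finite circ circ ..
  have mean: "(\<integral>\<^sup>+t. ennreal (poisson (?u t) (cis s) / (2*pi)) \<partial>circ) = ennreal (poisson (\<psi> 0) (cis s))"
    for s
  proof -
    let ?F = "\<lambda>z. (cis s + \<psi> z) / (cis s - \<psi> z)"
    have ne: "cis s - \<psi> z \<noteq> 0" if "z \<in> \<D>" for z
    proof
      assume "cis s - \<psi> z = 0"
      then have "cmod (\<psi> z) = 1" by (metis eq_iff_diff_eq_0 norm_cis)
      then show False using \<psi>(2) that by force
    qed
    have "?F holomorphic_on \<D>"
      using ne by (intro holomorphic_intros \<psi>(1)) auto
    from integral_Re_circle[OF this r]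
    have "((\<lambda>t. poisson (?u t) (cis s)) has_integral 2 * pi * poisson (\<psi> 0) (cis s)) {0..2*pi}"
      by (simp add: poisson_eq_Re)
    from has_integral_divide[OF this, of "2*pi"]
    have I: "((\<lambda>t. poisson (?u t) (cis s) / (2*pi)) has_integral poisson (\<psi> 0) (cis s)) {0..2*pi}"
      by simp
    have "continuous_on {0..2*pi} ?u"
      by (intro continuous_on_compose2[OF holomorphic_on_imp_continuous_on[OF \<psi>(1)]])
         (use rD in \<open>auto intro!: continuous_intros\<close>)
    then have "continuous_on {0..2*pi} (\<lambda>t. poisson (?u t) (cis s) / (2*pi))"
      unfolding poisson_def using ne rD by (intro continuous_intros) auto
    then show ?thesis
      using P0 integral_unique[OF I] by (subst nn_integral_circ) (auto simp del: integral_divide)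
  qed
  have "(\<integral>\<^sup>+t. ennreal (cmod (g (?u t)) powr p) \<partial>circ)
      \<le> (\<integral>\<^sup>+t. (\<integral>\<^sup>+s. ennreal (poisson (?u t) (cis s) / (2*pi)) * ?q s \<partial>circ) \<partial>circ)"
    using g uD by (intro nn_integral_mono) (auto simp: poisson_dominated_def)
  also have "\<dots> = (\<integral>\<^sup>+s. (\<integral>\<^sup>+t. ennreal (poisson (?u t) (cis s) / (2*pi)) * ?q s \<partial>circ) \<partial>circ)"
    unfolding poisson_def by (rule P.Fubini'[symmetric]) measurable
  also have "\<dots> = (\<integral>\<^sup>+s. ennreal (poisson (\<psi> 0) (cis s)) * ?q s \<partial>circ)"
  proof (intro nn_integral_cong)
    fix s
    have "(\<integral>\<^sup>+t. ennreal (poisson (?u t) (cis s) / (2*pi)) * ?q s \<partial>circ)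
        = (\<integral>\<^sup>+t. ennreal (poisson (?u t) (cis s) / (2*pi)) \<partial>circ) * ?q s"
      unfolding poisson_def by (rule nn_integral_multc) measurable
    then show "(\<integral>\<^sup>+t. ennreal (poisson (?u t) (cis s) / (2*pi)) * ?q s \<partial>circ)
        = ennreal (poisson (\<psi> 0) (cis s)) * ?q s"
      by (simp add: mean)
  qed
  also have "\<dots> \<le> (\<integral>\<^sup>+s. ennreal (2 / (1 - cmod (\<psi> 0))) * ?q s \<partial>circ)"
  proof (intro nn_integral_mono mult_right_mono ennreal_leI poisson_le)
    have "\<psi> 0 \<in> \<D>" using \<psi>(2) by (auto simp: image_subset_iff)
    then show "cmod (\<psi> 0) < 1" by simp
  qed auto
  also have "\<dots> = ennreal (2 / (1 - cmod (\<psi> 0))) * (\<integral>\<^sup>+s. ?q s \<partial>circ)"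
    by (rule nn_integral_cmult) measurable
  finally show ?thesis .
qed

section \<open>Functions with a mild singularity at one boundary point\<close>

text \<open>
  Bounded multipliers that vanish at \<open>\<alpha>\<close> and tend to \<open>1\<close> elsewhere: the pole
  \<open>(1 + 1 / (n + 1)) * \<alpha>\<close> lies outside the closed disc and approaches the zero \<open>\<alpha>\<close>.
\<close>
definition damp :: "nat \<Rightarrow> complex \<Rightarrow> complex" where
  "damp n z = (\<alpha> - z) / (\<alpha> - z + \<alpha> / of_nat (Suc n))"

lemma damp_denominator:
  assumes "z \<in> cball 0 1"
  shows "cmod (\<alpha> - z) \<le> cmod (\<alpha> - z + \<alpha> / of_nat (Suc n))"
    and "1 / real (Suc n) \<le> cmod (\<alpha> - z + \<alpha> / of_nat (Suc n))"
    and "\<alpha> - z + \<alpha> / of_nat (Suc n) \<noteq> 0"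
proof -
  let ?e = "1 / real (Suc n)"
  have e: "\<alpha> - z + \<alpha> / of_nat (Suc n) = of_real (1 + ?e) * \<alpha> - z"
    by (simp add: algebra_simps)
  have "1 + ?e = cmod (of_real (1 + ?e) * \<alpha>)"
    unfolding norm_mult norm_of_real norm_\<alpha> by simp
  also have "\<dots> - cmod z \<le> cmod (of_real (1 + ?e) * \<alpha> - z)"
    by (rule norm_triangle_ineq2)
  finally show 2: "1 / real (Suc n) \<le> cmod (\<alpha> - z + \<alpha> / of_nat (Suc n))"
    unfolding e using assms by simp
  have "0 < 1 / real (Suc n)" by simp
  with 2 show "\<alpha> - z + \<alpha> / of_nat (Suc n) \<noteq> 0"
    by (metis norm_zero not_less)
  have "inner (\<alpha> - z) \<alpha> \<ge> 0"
    using norm_cauchy_schwarz[of z \<alpha>] assms norm_\<alpha>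
    by (simp add: inner_diff_left dot_square_norm)
  then have "0 \<le> inner (\<alpha> - z) (?e *\<^sub>R \<alpha>)" by simp
  moreover have "(cmod (\<alpha> - z + ?e *\<^sub>R \<alpha>))\<^sup>2
      = (cmod (\<alpha> - z))\<^sup>2 + 2 * inner (\<alpha> - z) (?e *\<^sub>R \<alpha>) + (cmod (?e *\<^sub>R \<alpha>))\<^sup>2"
    unfolding power2_norm_eq_inner inner_add_left inner_add_right
    by (simp add: inner_commute)
  ultimately have "(cmod (\<alpha> - z))\<^sup>2 \<le> (cmod (\<alpha> - z + ?e *\<^sub>R \<alpha>))\<^sup>2" by simp
  then show "cmod (\<alpha> - z) \<le> cmod (\<alpha> - z + \<alpha> / of_nat (Suc n))"
    by (auto simp: scaleR_conv_of_real dest: power2_le_imp_le)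
qed

lemma norm_damp_le_1: "z \<in> cball 0 1 \<Longrightarrow> cmod (damp n z) \<le> 1"
  using damp_denominator[of z n] by (simp add: damp_def norm_divide divide_le_eq_1)

lemma norm_damp_le:
  assumes "z \<in> cball 0 1"
  shows "cmod (damp n z) \<le> real (Suc n) * cmod (\<alpha> - z)"
proof -
  have "cmod (damp n z) \<le> cmod (\<alpha> - z) / (1 / real (Suc n))"
    unfolding damp_def norm_divide
    using damp_denominator(2)[OF assms, of n] by (intro divide_left_mono mult_pos_pos) auto
  then show ?thesis by (simp add: mult.commute)
qed

lemma damp_tendsto:
  assumes "z \<noteq> \<alpha>"
  shows "(\<lambda>n. damp n z) \<longlonglongrightarrow> 1"
proof -
  have "(\<lambda>n. \<alpha> * of_real (inverse (real (Suc n)))) \<longlonglongrightarrow> \<alpha> * of_real 0"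
    by (intro tendsto_mult tendsto_const tendsto_of_real LIMSEQ_inverse_real_of_nat)
  then have "(\<lambda>n. \<alpha> / of_nat (Suc n)) \<longlonglongrightarrow> 0"
    by (simp add: divide_inverse of_real_inverse del: of_nat_Suc)
  then have "(\<lambda>n. (\<alpha> - z) / (\<alpha> - z + \<alpha> / of_nat (Suc n))) \<longlonglongrightarrow> (\<alpha> - z) / (\<alpha> - z + 0)"
    using assms by (intro tendsto_divide tendsto_add tendsto_const) auto
  then show ?thesis
    using assms by (simp add: damp_def)
qed

lemma damp_holomorphic: "damp n holomorphic_on \<D>"
  unfolding damp_def using damp_denominator(3) by (intro holomorphic_intros) auto

lemma damp_continuous: "continuous_on (cball 0 1) (damp n)"
  unfolding damp_def using damp_denominator(3) by (intro continuous_intros) auto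

text \<open>
  The exponent \<open>2\<close> suits compositions of Hardy functions with parabolic maps, for which
  \<open>cmod (h z) powr p\<close> is at most of order \<open>1 / (cmod (\<alpha> - z))\<^sup>2\<close> and \<open>p \<ge> 1\<close>.
\<close>
definition mild :: "(complex \<Rightarrow> complex) \<Rightarrow> bool" where
  "mild h \<longleftrightarrow> h holomorphic_on \<D> \<and> continuous_on (cball 0 1 - {\<alpha>}) h \<and>
     (\<exists>C. \<forall>z\<in>cball 0 1 - {\<alpha>}. cmod (h z) * (cmod (\<alpha> - z))\<^sup>2 \<le> C)"

text \<open>
  The cube of \<open>damp n\<close> beats the singularity, so that \<open>h * damp n ^ 3\<close> is continuous on the closed disc
  with value \<open>0\<close> at \<open>\<alpha>\<close>. On the circle its modulus is at most that of \<open>h\<close>, and at interior points it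
  tends to \<open>h\<close>.
\<close>
lemma mild_poisson_dominated:
  assumes "mild h"
  shows "poisson_dominated h"
  unfolding poisson_dominated_def
proof (intro conjI ballI)
  have hol: "h holomorphic_on \<D>" and cont: "continuous_on (cball 0 1 - {\<alpha>}) h"
    using assms by (auto simp: mild_def)
  obtain C where C: "\<And>z. z \<in> cball 0 1 - {\<alpha>} \<Longrightarrow> cmod (h z) * (cmod (\<alpha> - z))\<^sup>2 \<le> C"
    using assms unfolding mild_def by blast
  show "(\<lambda>t. h (cis t)) \<in> borel_measurable circ"
    by (rule measurable_circ_boundary[OF cont])
  define H where "H n z = (if z = \<alpha> then 0 else h z * damp n z ^ 3)" for n z
  have \<alpha>_notin: "\<alpha> \<notin> \<D>" using norm_\<alpha> by simp
  have H_le: "cmod (H n z) \<le> cmod (h z)" if "z \<in> cball 0 1" for n z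
    using norm_damp_le_1[OF that, of n]
    by (auto simp: H_def norm_mult norm_power power_le_one mult_left_le)
  have H_hol: "H n holomorphic_on \<D>" for n
  proof -
    have "(\<lambda>z. h z * damp n z ^ 3) holomorphic_on \<D>"
      by (intro holomorphic_intros hol damp_holomorphic)
    then show ?thesis
      by (rule holomorphic_transform) (use \<alpha>_notin in \<open>auto simp: H_def\<close>)
  qed
  have H_cont: "continuous_on (cball 0 1) (H n)" for n
    unfolding continuous_on_eq_continuous_within
  proof
    fix z :: complex assume z: "z \<in> cball 0 1"
    show "continuous (at z within cball 0 1) (H n)"
    proof (cases "z = \<alpha>")
      case True
      have bound: "cmod (H n y) \<le> C * real (Suc n) ^ 3 * cmod (\<alpha> - y)" if y: "y \<in> cball 0 1 - {\<alpha>}" for y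
      proof -
        have "cmod (damp n y) ^ 3 \<le> (real (Suc n) * cmod (\<alpha> - y)) ^ 3"
          using y by (intro power_mono norm_damp_le) auto
        then have "cmod (H n y) \<le> cmod (h y) * (real (Suc n) * cmod (\<alpha> - y)) ^ 3"
          using y by (auto simp: H_def norm_mult norm_power intro!: mult_left_mono)
        also have "\<dots> = (cmod (h y) * (cmod (\<alpha> - y))\<^sup>2) * (real (Suc n) ^ 3 * cmod (\<alpha> - y))"
          by (simp add: power_mult_distrib power2_eq_square power3_eq_cube del: of_nat_Suc)
        also have "\<dots> \<le> C * (real (Suc n) ^ 3 * cmod (\<alpha> - y))"
          using C[OF y] by (intro mult_right_mono) auto
        finally show ?thesis by (simp add: mult.assoc)
      qed
      have "(H n \<longlongrightarrow> 0) (at \<alpha> within cball 0 1)"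
      proof (rule Lim_null_comparison)
        show "\<forall>\<^sub>F y in at \<alpha> within cball 0 1. cmod (H n y) \<le> C * real (Suc n) ^ 3 * cmod (\<alpha> - y)"
          using bound by (auto simp: eventually_at_filter intro!: always_eventually)
        have "((\<lambda>y. C * real (Suc n) ^ 3 * cmod (\<alpha> - y)) \<longlongrightarrow> C * real (Suc n) ^ 3 * cmod (\<alpha> - \<alpha>)) (at \<alpha> within cball 0 1)"
          by (intro tendsto_intros)
        then show "((\<lambda>y. C * real (Suc n) ^ 3 * cmod (\<alpha> - y)) \<longlongrightarrow> 0) (at \<alpha> within cball 0 1)"
          by simp
      qed
      then show ?thesis
        using True by (simp add: continuous_within H_def)
    next
      case False
      have "continuous_on (cball 0 1 - {\<alpha>}) (\<lambda>z. h z * damp n z ^ 3)"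
        by (intro continuous_intros cont continuous_on_subset[OF damp_continuous]) auto
      then have "continuous_on (cball 0 1 - {\<alpha>}) (H n)"
        by (rule continuous_on_cong[THEN iffD1, rotated 2]) (auto simp: H_def)
      then have "continuous (at z within cball 0 1 - {\<alpha>}) (H n)"
        using z False by (simp add: continuous_on_eq_continuous_within)
      moreover have "at z within cball 0 1 - {\<alpha>} = at z within cball 0 1"
        by (rule at_within_nhd[of z "- {\<alpha>}"]) (use False in auto)
      ultimately show ?thesis by simp
    qed
  qed
  fix z assume z: "z \<in> \<D>"
  let ?R = "\<integral>\<^sup>+t. ennreal (poisson z (cis t) / (2*pi)) * ennreal (cmod (h (cis t)) powr p) \<partial>circ"
  have le: "ennreal (cmod (H n z) powr p) \<le> ?R" for n
  proof -
    have "ennreal (cmod (H n z) powr p)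
        \<le> (\<integral>\<^sup>+t. ennreal (poisson z (cis t) / (2*pi)) * ennreal (cmod (H n (cis t)) powr p) \<partial>circ)"
      using poisson_dominated_continuous[OF H_cont H_hol] z by (auto simp: poisson_dominated_def)
    also have "\<dots> \<le> ?R"
      using p by (intro nn_integral_mono mult_left_mono ennreal_leI powr_mono2 H_le) auto
    finally show ?thesis .
  qed
  have lim: "(\<lambda>n. ennreal (cmod (H n z) powr p)) \<longlonglongrightarrow> ennreal (cmod (h z) powr p)"
  proof -
    have "z \<noteq> \<alpha>" using z \<alpha>_notin by auto
    then have "(\<lambda>n. h z * damp n z ^ 3) \<longlonglongrightarrow> h z * 1 ^ 3"
      by (intro tendsto_intros damp_tendsto)
    then have "(\<lambda>n. H n z) \<longlonglongrightarrow> h z"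
      using \<open>z \<noteq> \<alpha>\<close> by (simp add: H_def)
    then show ?thesis
      using p by (intro tendsto_ennrealI tendsto_powr' tendsto_norm tendsto_const) auto
  qed
  show "ennreal (cmod (h z) powr p) \<le> ?R"
    by (rule Lim_bounded[OF lim]) (use le in blast)
qed

end

section \<open>Hardy spaces and bounded operators\<close>

lemma hardy_integral_nonneg: "0 \<le> hardy_integral q f r"
  unfolding hardy_integral_def
  by (cases "(\<lambda>\<theta>. cmod (f (of_real r * cis \<theta>)) powr q) integrable_on {0..2*pi}")
     (auto intro: integral_nonneg simp: not_integrable_integral)

text \<open>
  The \<open>q\<close>-th power of the Hardy norm, in terms of which all estimates are linear.
\<close>
definition hardy_sup :: "real \<Rightarrow> (complex \<Rightarrow> complex) \<Rightarrow> real" where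
  "hardy_sup q f = (SUP r\<in>{0<..<1}. hardy_integral q f r)"

lemma hardy_integral_le_sup:
  assumes "f \<in> hardy_space q" "0 < r" "r < 1"
  shows "hardy_integral q f r \<le> hardy_sup q f"
  unfolding hardy_sup_def using assms by (intro cSUP_upper) (auto simp: hardy_space_def)

lemma hardy_sup_nonneg:
  assumes "f \<in> hardy_space q"
  shows "0 \<le> hardy_sup q f"
  using hardy_integral_le_sup[OF assms, of "1/2"] hardy_integral_nonneg[of q f "1/2"] by simp

lemma hardy_spaceI:
  assumes "f holomorphic_on \<D>" "\<And>z. z \<notin> \<D> \<Longrightarrow> f z = 0"
    and "\<And>r. 0 < r \<Longrightarrow> r < 1 \<Longrightarrow> hardy_integral q f r \<le> B"
  shows "f \<in> hardy_space q" and "hardy_sup q f \<le> B"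
  using assms unfolding hardy_space_def hardy_sup_def
  by (auto intro!: bdd_aboveI2[of _ _ B] cSUP_least)

definition cut :: "(complex \<Rightarrow> complex) \<Rightarrow> complex \<Rightarrow> complex" where
  "cut h = (\<lambda>z. if z \<in> \<D> then h z else 0)"

lemma cut_holomorphic: "h holomorphic_on \<D> \<Longrightarrow> cut h holomorphic_on \<D>"
  by (rule holomorphic_transform) (auto simp: cut_def)

lemma hardy_integral_cut:
  assumes "0 \<le> r" "r < 1"
  shows "hardy_integral q (cut h) r = hardy_integral q h r"
  using assms by (simp add: hardy_integral_def cut_def norm_mult)

lemma hardy_op_sup_bound:
  assumes "J \<in> hardy_ops q" "1 \<le> q"
  obtains K where "0 \<le> K" "\<And>f. f \<in> hardy_space q \<Longrightarrow> hardy_sup q (J f) \<le> K * hardy_sup q f"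
proof -
  obtain L where L: "\<And>f. f \<in> hardy_space q \<Longrightarrow> hardy_norm q (J f) \<le> L * hardy_norm q f"
    and mem: "\<And>f. f \<in> hardy_space q \<Longrightarrow> J f \<in> hardy_space q"
    using assms unfolding hardy_ops_def by blast
  have norm_eq: "hardy_norm q f powr q = hardy_sup q f" if "f \<in> hardy_space q" for f
    using hardy_sup_nonneg[OF that] assms(2)
    by (simp add: hardy_norm_def flip: hardy_sup_def) (simp add: powr_powr)
  show ?thesis
  proof
    fix f assume f: "f \<in> hardy_space q"
    have n0: "0 \<le> hardy_norm q g" for g by (simp add: hardy_norm_def)
    have "hardy_norm q (J f) \<le> \<bar>L\<bar> * hardy_norm q f"
      using L[OF f] n0[of f] by (smt (verit) mult_right_mono)
    then have "hardy_norm q (J f) powr q \<le> (\<bar>L\<bar> * hardy_norm q f) powr q"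
      using assms(2) n0 by (intro powr_mono2) auto
    then show "hardy_sup q (J f) \<le> \<bar>L\<bar> powr q * hardy_sup q f"
      using n0 by (simp add: powr_mult norm_eq f mem)
  qed simp
qed

text \<open>
  Fatou's lemma for a pointwise limit.
\<close>
lemma nn_integral_limit_bound:
  fixes u :: "nat \<Rightarrow> 'a \<Rightarrow> ennreal"
  assumes "\<And>n. u n \<in> borel_measurable M" "\<And>t. t \<in> space M \<Longrightarrow> (\<lambda>n. u n t) \<longlonglongrightarrow> v t"
    and "\<And>n. (\<integral>\<^sup>+t. u n t \<partial>M) \<le> B"
  shows "(\<integral>\<^sup>+t. v t \<partial>M) \<le> B"
proof -
  have "(\<integral>\<^sup>+t. v t \<partial>M) = (\<integral>\<^sup>+t. liminf (\<lambda>n. u n t) \<partial>M)"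
    by (intro nn_integral_cong lim_imp_Liminf[symmetric] assms(2)) auto
  also have "\<dots> \<le> liminf (\<lambda>n. \<integral>\<^sup>+t. u n t \<partial>M)"
    by (rule nn_integral_liminf[OF assms(1)])
  also have "\<dots> \<le> liminf (\<lambda>n::nat. B)"
    by (intro Liminf_mono always_eventually allI assms(3))
  also have "\<dots> = B" by (simp add: Liminf_const)
  finally show ?thesis .
qed

definition radius :: "nat \<Rightarrow> real" where
  "radius n = 1 - 1 / real (Suc (Suc n))"

lemma radius_bounds: "0 < radius n" "radius n < 1"
  by (auto simp: radius_def)

lemma radius_tendsto: "radius \<longlonglongrightarrow> 1"
proof -
  have "(\<lambda>n. 1 / real (Suc n)) \<longlonglongrightarrow> 0"
    using LIMSEQ_inverse_real_of_nat by (simp add: inverse_eq_divide)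
  then have "(\<lambda>n. 1 / real (Suc (Suc n))) \<longlonglongrightarrow> 0"
    by (rule LIMSEQ_Suc)
  then have "(\<lambda>n. 1 - 1 / real (Suc (Suc n))) \<longlonglongrightarrow> 1 - 0"
    by (intro tendsto_diff tendsto_const)
  then show ?thesis unfolding radius_def by simp
qed

lemma radius_cball:
  assumes "z \<in> cball 0 1"
  shows "of_real (radius n) * z \<in> \<D>"
proof -
  have "radius n * cmod z \<le> radius n * 1"
    using assms radius_bounds[of n] by (intro mult_left_mono) auto
  also have "\<dots> < 1" using radius_bounds[of n] by simp
  finally show ?thesis
    using radius_bounds[of n] by (simp add: norm_mult)
qed

lemma dilate_holomorphic:
  "f holomorphic_on \<D> \<Longrightarrow> (\<lambda>z. f (of_real (radius n) * z)) holomorphic_on \<D>"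
  by (rule holomorphic_on_compose_gen[of _ _ f, unfolded o_def])
     (use radius_cball in \<open>fastforce intro!: holomorphic_intros\<close>)+

lemma dilate_continuous:
  "f holomorphic_on \<D> \<Longrightarrow> continuous_on (cball 0 1) (\<lambda>z. f (of_real (radius n) * z))"
  by (rule continuous_on_compose2[OF holomorphic_on_imp_continuous_on])
     (use radius_cball in \<open>fastforce intro!: continuous_intros\<close>)+

lemma dilate_tendsto:
  fixes z :: complex
  assumes "isCont f z"
  shows "(\<lambda>n. f (of_real (radius n) * z)) \<longlonglongrightarrow> f z"
proof -
  have "(\<lambda>n. of_real (radius n) * z) \<longlonglongrightarrow> of_real 1 * z"
    by (intro tendsto_mult tendsto_const tendsto_of_real radius_tendsto)
  then show ?thesis
    using isCont_tendsto_compose[OF assms] by simp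
qed

lemma holomorphic_disc_isCont:
  "f holomorphic_on \<D> \<Longrightarrow> z \<in> \<D> \<Longrightarrow> isCont f z"
  using holomorphic_on_imp_continuous_on continuous_on_eq_continuous_at open_ball by blast

lemma self_map_norm_0:
  assumes "\<phi> ` \<D> \<subseteq> \<D>"
  shows "cmod (\<phi> 0) < 1"
proof -
  have "\<phi> 0 \<in> \<D>" using assms by (auto simp: image_subset_iff)
  then show ?thesis by simp
qed

context punctured_circle
begin

text \<open>
  The Poisson inequality for the dilations of \<open>f\<close>, with the kernel estimated by its maximum. The
  factor \<open>2\<close> of that estimate cancels against \<open>2 * pi\<close>, and \<open>1 / pi \<le> 1\<close>.
\<close>
lemma point_evaluation_bound:
  assumes f: "f \<in> hardy_space p" and z: "z \<in> \<D>"
  shows "cmod (f z) powr p \<le> hardy_sup p f / (1 - cmod z)"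
proof (rule LIMSEQ_le_const2)
  have hol: "f holomorphic_on \<D>" using f by (simp add: hardy_space_def)
  show "(\<lambda>n. cmod (f (of_real (radius n) * z)) powr p) \<longlonglongrightarrow> cmod (f z) powr p"
    using p by (intro tendsto_powr' tendsto_norm dilate_tendsto tendsto_const
        holomorphic_disc_isCont[OF hol z]) auto
  have "cmod (f (of_real (radius n) * z)) powr p \<le> hardy_sup p f / (1 - cmod z)" for n
  proof -
    let ?F = "\<lambda>z. f (of_real (radius n) * z)"
    have cF: "continuous_on {0..2*pi} (\<lambda>t. ?F (cis t))"
      by (rule continuous_on_compose2[OF dilate_continuous[OF hol]]) (auto intro!: continuous_intros)
    have c: "continuous_on {0..2*pi} (\<lambda>t. cmod (?F (cis t)) powr p)"
      using p by (intro continuous_intros cF continuous_on_powr') auto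
    have "2 * pi * cmod (?F z) powr p
        \<le> integral {0..2*pi} (\<lambda>t. poisson z (cis t) * cmod (?F (cis t)) powr p)"
      by (rule poisson_inequality[OF dilate_continuous[OF hol] dilate_holomorphic[OF hol] z p])
    also have "\<dots> \<le> integral {0..2*pi} (\<lambda>t. 2 / (1 - cmod z) * cmod (?F (cis t)) powr p)"
      using z by (intro integral_le integrable_continuous_interval mult_right_mono poisson_le
          continuous_on_mult continuous_on_poisson_cis continuous_on_const c) auto
    also have "\<dots> = 2 / (1 - cmod z) * hardy_integral p f (radius n)"
      by (simp add: hardy_integral_def)
    also have "\<dots> \<le> 2 / (1 - cmod z) * hardy_sup p f"
      using z by (intro mult_left_mono hardy_integral_le_sup f radius_bounds) auto
    finally have "pi * cmod (?F z) powr p \<le> hardy_sup p f / (1 - cmod z)" by simp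
    moreover have "1 * cmod (?F z) powr p \<le> pi * cmod (?F z) powr p"
      using pi_ge_two by (intro mult_right_mono) auto
    ultimately show ?thesis by simp
  qed
  then show "\<exists>N. \<forall>n\<ge>N. cmod (f (of_real (radius n) * z)) powr p \<le> hardy_sup p f / (1 - cmod z)"
    by blast
qed

text \<open>
  Littlewood's subordination applies to the dilations of \<open>f\<close>, which are continuous on the closed disc;
  Fatou's lemma removes the dilation.
\<close>
lemma comp_op_bounded:
  assumes \<phi>: "\<phi> holomorphic_on \<D>" "\<phi> ` \<D> \<subseteq> \<D>" and f: "f \<in> hardy_space p"
  shows "comp_op \<phi> f \<in> hardy_space p"
    and "hardy_sup p (comp_op \<phi> f) \<le> 2 / (1 - cmod (\<phi> 0)) * hardy_sup p f"
proof -
  have hol: "f holomorphic_on \<D>" using f by (simp add: hardy_space_def)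
  have comp_cut: "comp_op \<phi> f = cut (\<lambda>z. f (\<phi> z))"
    by (simp add: comp_op_def cut_def)
  have hol': "(\<lambda>z. f (\<phi> z)) holomorphic_on \<D>"
    using holomorphic_on_compose_gen[OF \<phi>(1) hol \<phi>(2)] by (simp add: o_def)
  have K: "0 \<le> 2 / (1 - cmod (\<phi> 0))"
    using self_map_norm_0[OF \<phi>(2)] by simp
  have "hardy_integral p (comp_op \<phi> f) r \<le> 2 / (1 - cmod (\<phi> 0)) * hardy_sup p f"
    if r: "0 < r" "r < 1" for r
  proof -
    have rD: "of_real r * cis t \<in> \<D>" for t using r by (simp add: norm_mult)
    then have \<phi>D: "\<phi> (of_real r * cis t) \<in> \<D>" for t using \<phi>(2) by blast
    let ?B = "ennreal (2 / (1 - cmod (\<phi> 0)) * hardy_sup p f)"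
    have "(\<integral>\<^sup>+t. ennreal (cmod (f (\<phi> (of_real r * cis t))) powr p) \<partial>circ) \<le> ?B"
    proof (rule nn_integral_limit_bound)
      fix n
      let ?g = "\<lambda>z. f (of_real (radius n) * z)"
      have "continuous_on punct (\<lambda>t. of_real r * cis t)"
        by (intro continuous_intros)
      then have "continuous_on punct (\<lambda>t. \<phi> (of_real r * cis t))"
        by (rule continuous_on_compose2[OF holomorphic_on_imp_continuous_on[OF \<phi>(1)]])
           (use rD in blast)
      then have "continuous_on punct (\<lambda>t. ?g (\<phi> (of_real r * cis t)))"
        by (rule continuous_on_compose2[OF dilate_continuous[OF hol]])
           (use \<phi>D ball_subset_cball in blast)
      then have [measurable]: "(\<lambda>t. ?g (\<phi> (of_real r * cis t))) \<in> borel_measurable circ"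
        by (rule measurable_circ)
      show "(\<lambda>t. ennreal (cmod (?g (\<phi> (of_real r * cis t))) powr p)) \<in> borel_measurable circ"
        by measurable
      have "(\<integral>\<^sup>+t. ennreal (cmod (?g (\<phi> (of_real r * cis t))) powr p) \<partial>circ)
          \<le> ennreal (2 / (1 - cmod (\<phi> 0))) * (\<integral>\<^sup>+t. ennreal (cmod (?g (cis t)) powr p) \<partial>circ)"
        by (intro littlewood_subordination[of ?g] poisson_dominated_continuous dilate_continuous
            dilate_holomorphic hol \<phi> r)
      also have "(\<integral>\<^sup>+t. ennreal (cmod (?g (cis t)) powr p) \<partial>circ) = ennreal (hardy_integral p f (radius n))"
        using radius_bounds[of n]
        by (intro pow_mean_circ holomorphic_on_imp_continuous_on[OF hol]) auto
      also have "ennreal (2 / (1 - cmod (\<phi> 0))) * \<dots> \<le> ennreal (2 / (1 - cmod (\<phi> 0))) * ennreal (hardy_sup p f)"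
        by (intro mult_left_mono ennreal_leI hardy_integral_le_sup f radius_bounds) auto
      also have "\<dots> = ?B"
        using K hardy_sup_nonneg[OF f] by (simp only: ennreal_mult)
      finally show "(\<integral>\<^sup>+t. ennreal (cmod (?g (\<phi> (of_real r * cis t))) powr p) \<partial>circ) \<le> ?B" .
    next
      fix t
      show "(\<lambda>n. ennreal (cmod (f (of_real (radius n) * \<phi> (of_real r * cis t))) powr p))
          \<longlonglongrightarrow> ennreal (cmod (f (\<phi> (of_real r * cis t))) powr p)"
        using p by (intro tendsto_ennrealI tendsto_powr' tendsto_norm dilate_tendsto tendsto_const
            holomorphic_disc_isCont[OF hol \<phi>D]) auto
    qed
    then have "ennreal (hardy_integral p (\<lambda>z. f (\<phi> z)) r) \<le> ?B"
      using pow_mean_circ[OF holomorphic_on_imp_continuous_on[OF hol'], of r] r by simp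
    then show ?thesis
      using r K hardy_sup_nonneg[OF f]
      by (subst (asm) ennreal_le_iff) (auto simp: comp_cut hardy_integral_cut)
  qed
  then show "comp_op \<phi> f \<in> hardy_space p"
    and "hardy_sup p (comp_op \<phi> f) \<le> 2 / (1 - cmod (\<phi> 0)) * hardy_sup p f"
    using hardy_spaceI[of "comp_op \<phi> f" p] cut_holomorphic[OF hol']
    by (auto simp: comp_cut cut_def)
qed

lemma comp_op_in_hardy_ops:
  assumes \<phi>: "\<phi> holomorphic_on \<D>" "\<phi> ` \<D> \<subseteq> \<D>"
  shows "comp_op \<phi> \<in> hardy_ops p"
  unfolding hardy_ops_def
proof (intro CollectI conjI ballI allI)
  fix f assume "f \<in> hardy_space p"
  then show "comp_op \<phi> f \<in> hardy_space p" by (rule comp_op_bounded(1)[OF \<phi>])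
next
  let ?K = "2 / (1 - cmod (\<phi> 0))"
  have K: "0 \<le> ?K"
    using self_map_norm_0[OF \<phi>(2)] by simp
  show "\<exists>L. \<forall>f\<in>hardy_space p. hardy_norm p (comp_op \<phi> f) \<le> L * hardy_norm p f"
  proof (intro exI ballI)
    fix f assume f: "f \<in> hardy_space p"
    have "hardy_sup p (comp_op \<phi> f) powr (1/p) \<le> (?K * hardy_sup p f) powr (1/p)"
      using p by (intro powr_mono2 comp_op_bounded(2)[OF \<phi> f] hardy_sup_nonneg
          comp_op_bounded(1)[OF \<phi> f]) auto
    also have "\<dots> = ?K powr (1/p) * hardy_sup p f powr (1/p)"
      using K hardy_sup_nonneg[OF f] by (intro powr_mult)
    finally show "hardy_norm p (comp_op \<phi> f) \<le> ?K powr (1/p) * hardy_norm p f"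
      by (simp only: hardy_norm_def hardy_sup_def)
  qed
next
  fix f g and c :: complex
  show "comp_op \<phi> (\<lambda>z. f z + g z) = (\<lambda>z. comp_op \<phi> f z + comp_op \<phi> g z)"
    and "comp_op \<phi> (\<lambda>z. c * f z) = (\<lambda>z. c * comp_op \<phi> f z)"
    by (auto simp: comp_op_def)
qed

definition circ_pow :: "(complex \<Rightarrow> complex) \<Rightarrow> ennreal" where
  "circ_pow h = (\<integral>\<^sup>+t. ennreal (cmod (h (cis t)) powr p) \<partial>circ)"

text \<open>
  Subordination with the identity map, for which the constant is \<open>2\<close>.
\<close>
lemma mild_in_hardy_space:
  assumes h: "mild h" and fin: "circ_pow h < \<infinity>"
  shows "cut h \<in> hardy_space p" and "hardy_sup p (cut h) \<le> 2 * enn2real (circ_pow h)"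
proof -
  have hol: "h holomorphic_on \<D>" using h by (simp add: mild_def)
  have "hardy_integral p (cut h) r \<le> 2 * enn2real (circ_pow h)" if r: "0 < r" "r < 1" for r
  proof -
    have "ennreal (hardy_integral p h r) \<le> ennreal (2 / (1 - cmod 0)) * circ_pow h"
      using littlewood_subordination[OF mild_poisson_dominated[OF h], of "\<lambda>z. z" r] r
        pow_mean_circ[OF holomorphic_on_imp_continuous_on[OF hol], of r]
      by (simp add: circ_pow_def)
    also have "circ_pow h = ennreal (enn2real (circ_pow h))"
      using fin by simp
    also have "ennreal (2 / (1 - cmod 0)) * \<dots> = ennreal (2 * enn2real (circ_pow h))"
      by (simp add: ennreal_mult)
    finally show ?thesis
      using r by (simp add: hardy_integral_cut)
  qed
  then show "cut h \<in> hardy_space p" and "hardy_sup p (cut h) \<le> 2 * enn2real (circ_pow h)"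
    using hardy_spaceI[of "cut h" p] cut_holomorphic[OF hol] by (auto simp: cut_def)
qed

lemma mild_add:
  assumes "mild g" "mild h"
  shows "mild (\<lambda>z. g z + h z)"
proof -
  obtain C where C: "\<forall>z\<in>cball 0 1 - {\<alpha>}. cmod (g z) * (cmod (\<alpha> - z))\<^sup>2 \<le> C"
    using assms unfolding mild_def by blast
  obtain D where D: "\<forall>z\<in>cball 0 1 - {\<alpha>}. cmod (h z) * (cmod (\<alpha> - z))\<^sup>2 \<le> D"
    using assms unfolding mild_def by blast
  have bound: "cmod (g z + h z) * (cmod (\<alpha> - z))\<^sup>2 \<le> C + D" if "z \<in> cball 0 1 - {\<alpha>}" for z
  proof -
    have "cmod (g z + h z) * (cmod (\<alpha> - z))\<^sup>2 \<le> (cmod (g z) + cmod (h z)) * (cmod (\<alpha> - z))\<^sup>2"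
      by (intro mult_right_mono norm_triangle_ineq) auto
    then show ?thesis using bspec[OF C that] bspec[OF D that] by (simp add: algebra_simps)
  qed
  show ?thesis
    unfolding mild_def
  proof (intro conjI exI ballI)
    fix z assume "z \<in> cball 0 1 - {\<alpha>}"
    then show "cmod (g z + h z) * (cmod (\<alpha> - z))\<^sup>2 \<le> C + D" by (rule bound)
  qed (use assms in \<open>auto simp: mild_def intro!: holomorphic_intros continuous_intros\<close>)
qed

lemma mild_cmult:
  assumes "mild h"
  shows "mild (\<lambda>z. c * h z)"
proof -
  obtain C where C: "\<forall>z\<in>cball 0 1 - {\<alpha>}. cmod (h z) * (cmod (\<alpha> - z))\<^sup>2 \<le> C"
    using assms unfolding mild_def by blast
  have bound: "cmod (c * h z) * (cmod (\<alpha> - z))\<^sup>2 \<le> cmod c * C" if "z \<in> cball 0 1 - {\<alpha>}" for z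
    using mult_left_mono[OF bspec[OF C that], of "cmod c"] by (simp add: norm_mult mult.assoc)
  show ?thesis
    unfolding mild_def
  proof (intro conjI exI ballI)
    fix z assume "z \<in> cball 0 1 - {\<alpha>}"
    then show "cmod (c * h z) * (cmod (\<alpha> - z))\<^sup>2 \<le> cmod c * C" by (rule bound)
  qed (use assms in \<open>auto simp: mild_def intro!: holomorphic_intros continuous_intros\<close>)
qed

lemma circ_pow_dominated:
  assumes "\<And>t. t \<in> punct \<Longrightarrow> cmod (h (cis t)) \<le> k t" "(\<integral>\<^sup>+t. ennreal (k t powr p) \<partial>circ) < \<infinity>"
  shows "circ_pow h < \<infinity>"
proof -
  have "circ_pow h \<le> (\<integral>\<^sup>+t. ennreal (k t powr p) \<partial>circ)"
    unfolding circ_pow_def using p assms(1)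
    by (intro nn_integral_mono ennreal_leI powr_mono2) (auto simp: space_circ)
  then show ?thesis using assms(2) by (rule le_less_trans)
qed

text \<open>
  For mild functions the Hardy norm is controlled by the integral over the circle, so dominated
  convergence there is convergence in norm, which the bounded operator \<open>J\<close> and evaluation at \<open>z\<close>
  preserve.
\<close>
lemma hardy_op_dominated_convergence:
  assumes J: "J \<in> hardy_ops p" and hn: "\<And>n. mild (hs n)" and h: "mild h"
    and k [measurable]: "k \<in> borel_measurable circ"
    and fin: "(\<integral>\<^sup>+t. ennreal (k t powr p) \<partial>circ) < \<infinity>"
    and dom: "\<And>n t. t \<in> punct \<Longrightarrow> cmod (hs n (cis t)) \<le> k t"
    and lim: "\<And>t. t \<in> punct \<Longrightarrow> (\<lambda>n. hs n (cis t)) \<longlonglongrightarrow> h (cis t)"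
    and z: "z \<in> \<D>"
  shows "(\<lambda>n. J (cut (hs n)) z) \<longlonglongrightarrow> J (cut h) z"
proof -
  define d where "d n z = hs n z + (- 1) * h z" for n z
  have domh: "cmod (h (cis t)) \<le> k t" if "t \<in> punct" for t
    by (rule LIMSEQ_le_const2[OF tendsto_norm[OF lim[OF that]]]) (use dom[OF that] in blast)
  have d_mild: "mild (d n)" for n
    unfolding d_def by (intro mild_add mild_cmult hn h)
  have neg_mild: "mild (\<lambda>z. (-1) * h z)" by (intro mild_cmult h)
  have d_le: "cmod (d n (cis t)) \<le> 2 * k t" if "t \<in> punct" for n t
    using norm_triangle_ineq4[of "hs n (cis t)" "h (cis t)"] dom[OF that, of n] domh[OF that]
    by (simp add: d_def)
  have fin2: "(\<integral>\<^sup>+t. ennreal ((2 * k t) powr p) \<partial>circ) < \<infinity>"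
  proof -
    have "(\<integral>\<^sup>+t. ennreal ((2 * k t) powr p) \<partial>circ) = (\<integral>\<^sup>+t. ennreal (2 powr p) * ennreal (k t powr p) \<partial>circ)"
    proof (intro nn_integral_cong)
      fix t assume "t \<in> space circ"
      then have "0 \<le> k t"
        using order_trans[OF norm_ge_zero domh[of t]] by (simp add: space_circ)
      then show "ennreal ((2 * k t) powr p) = ennreal (2 powr p) * ennreal (k t powr p)"
        by (simp add: powr_mult ennreal_mult)
    qed
    also have "\<dots> = ennreal (2 powr p) * (\<integral>\<^sup>+t. ennreal (k t powr p) \<partial>circ)"
      by (rule nn_integral_cmult) measurable
    also have "\<dots> < \<infinity>" using fin by (simp add: ennreal_mult_less_top)
    finally show ?thesis .
  qed
  have in_space: "cut (hs n) \<in> hardy_space p" "cut (d n) \<in> hardy_space p" for n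
    using mild_in_hardy_space(1)[OF hn] circ_pow_dominated[OF dom fin]
      mild_in_hardy_space(1)[OF d_mild] circ_pow_dominated[OF d_le fin2] by auto
  have h_space: "cut h \<in> hardy_space p"
    using mild_in_hardy_space(1)[OF h] circ_pow_dominated[OF domh fin] by auto
  have neg_space: "cut (\<lambda>z. (-1) * h z) \<in> hardy_space p"
    using mild_in_hardy_space(1)[OF neg_mild] circ_pow_dominated[of "\<lambda>z. (-1) * h z" k] domh fin by auto
  have J_diff: "J (cut (d n)) z = J (cut (hs n)) z - J (cut h) z" for n
  proof -
    have add: "J (\<lambda>z. f z + g z) = (\<lambda>z. J f z + J g z)"
      if "f \<in> hardy_space p" "g \<in> hardy_space p" for f g
      using J that by (simp add: hardy_ops_def)
    have scale: "J (\<lambda>z. c * f z) = (\<lambda>z. c * J f z)" if "f \<in> hardy_space p" for f c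
      using J that by (simp add: hardy_ops_def)
    have "cut (d n) = (\<lambda>z. cut (hs n) z + cut (\<lambda>z. (-1) * h z) z)"
      by (auto simp: cut_def d_def)
    moreover have "cut (\<lambda>z. (-1) * h z) = (\<lambda>z. (-1) * cut h z)"
      by (auto simp: cut_def)
    ultimately show ?thesis
      using add[OF in_space(1)[of n] neg_space] scale[OF h_space, of "-1"] by simp
  qed
  have "circ_pow (d n) < \<infinity>" for n
    by (rule circ_pow_dominated[OF d_le fin2])
  have pow_lim: "(\<lambda>n. circ_pow (d n)) \<longlonglongrightarrow> (\<integral>\<^sup>+t. 0 \<partial>circ)"
    unfolding circ_pow_def
  proof (rule nn_integral_dominated_convergence[OF _ _ _ _ fin2])
    fix n
    have "(\<lambda>t. d n (cis t)) \<in> borel_measurable circ"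
      by (intro measurable_circ_boundary) (use d_mild in \<open>simp add: mild_def\<close>)
    then show "(\<lambda>t. ennreal (cmod (d n (cis t)) powr p)) \<in> borel_measurable circ"
      by measurable
    show "AE t in circ. ennreal (cmod (d n (cis t)) powr p) \<le> ennreal ((2 * k t) powr p)"
      using p d_le by (intro AE_I2 ennreal_leI powr_mono2) (auto simp: space_circ)
  next
    show "AE t in circ. (\<lambda>n. ennreal (cmod (d n (cis t)) powr p)) \<longlonglongrightarrow> 0"
    proof (intro AE_I2)
      fix t assume "t \<in> space circ"
      then have "(\<lambda>n. hs n (cis t) + (-1) * h (cis t)) \<longlonglongrightarrow> h (cis t) + (-1) * h (cis t)"
        by (intro tendsto_intros lim) (simp add: space_circ)
      then have "(\<lambda>n. d n (cis t)) \<longlonglongrightarrow> 0" by (simp add: d_def)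
      then have "(\<lambda>n. ennreal (cmod (d n (cis t)) powr p)) \<longlonglongrightarrow> ennreal (cmod 0 powr p)"
        using p by (intro tendsto_ennrealI tendsto_powr' tendsto_norm tendsto_const) auto
      then show "(\<lambda>n. ennreal (cmod (d n (cis t)) powr p)) \<longlonglongrightarrow> 0" by simp
    qed
  qed measurable
  have pow_lim0: "(\<lambda>n. enn2real (circ_pow (d n))) \<longlonglongrightarrow> 0"
    by (rule tendsto_enn2real) (use pow_lim in simp_all)
  obtain K where K: "0 \<le> K" "\<And>f. f \<in> hardy_space p \<Longrightarrow> hardy_sup p (J f) \<le> K * hardy_sup p f"
    using hardy_op_sup_bound[OF J p] by blast
  have bound: "cmod (J (cut (d n)) z) powr p \<le> K * (2 * enn2real (circ_pow (d n))) / (1 - cmod z)" for n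
  proof -
    have "cmod (J (cut (d n)) z) powr p \<le> hardy_sup p (J (cut (d n))) / (1 - cmod z)"
      by (intro point_evaluation_bound z) (use J in_space in \<open>simp add: hardy_ops_def\<close>)
    also have "\<dots> \<le> (K * hardy_sup p (cut (d n))) / (1 - cmod z)"
      using z by (intro divide_right_mono K in_space) auto
    also have "\<dots> \<le> K * (2 * enn2real (circ_pow (d n))) / (1 - cmod z)"
      using z K \<open>circ_pow (d n) < \<infinity>\<close>
      by (intro divide_right_mono mult_left_mono mild_in_hardy_space(2) d_mild) auto
    finally show ?thesis .
  qed
  have "(\<lambda>n. K * (2 * enn2real (circ_pow (d n))) / (1 - cmod z)) \<longlonglongrightarrow> K * (2 * 0) / (1 - cmod z)"
    using z by (intro tendsto_intros pow_lim0) auto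
  then have lim0: "(\<lambda>n. K * (2 * enn2real (circ_pow (d n))) / (1 - cmod z)) \<longlonglongrightarrow> 0"
    by simp
  have "(\<lambda>n. cmod (J (cut (d n)) z) powr p) \<longlonglongrightarrow> 0"
    by (rule Lim_null_comparison[OF always_eventually lim0]) (simp add: bound)
  then have "(\<lambda>n. (cmod (J (cut (d n)) z) powr p) powr (1/p)) \<longlonglongrightarrow> 0 powr (1/p)"
    using p by (intro tendsto_powr' tendsto_const) auto
  then have "(\<lambda>n. cmod (J (cut (hs n)) z - J (cut h) z)) \<longlonglongrightarrow> 0"
    using p by (simp add: powr_powr J_diff)
  then show ?thesis
    by (simp add: tendsto_norm_zero_iff LIM_zero_cancel)
qed

end

section \<open>Periodic functions of polynomial growth on a half-plane\<close>

lemma le_one_plus_powr: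
  fixes x q :: real
  assumes "1 \<le> q" "0 \<le> x"
  shows "x \<le> 1 + x powr q"
proof (cases "x \<le> 1")
  case False
  then have "x powr 1 \<le> x powr q" using assms by (intro powr_mono) auto
  then show ?thesis using False by simp
qed (simp add: add_increasing2)

lemma half_plane_periodic_nat:
  assumes "\<And>w. Re w > 0 \<Longrightarrow> Q (w + a) = Q w" "Re a > 0" "Re w > 0"
  shows "Q (w + of_nat n * a) = Q w"
proof (induction n)
  case (Suc n)
  have "Re (w + of_nat n * a) > 0" using assms(2,3) by (simp add: add_pos_nonneg)
  from assms(1)[OF this] show ?case using Suc by (simp add: algebra_simps)
qed simp

lemma quadratic_periodic_const:
  fixes a c0 c1 c2 :: complex
  assumes E: "\<And>w. E w = c0 + c1 * w + c2 * w\<^sup>2"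
    and per: "E a = E 0" "E (2 * a) = E 0" and a: "a \<noteq> 0"
  shows "c1 = 0 \<and> c2 = 0"
proof -
  have 1: "c1 * a + c2 * a\<^sup>2 = 0" using per(1) by (simp add: E)
  have "c1 * (2 * a) + c2 * (2 * a)\<^sup>2 = 0" using per(2) by (simp add: E)
  then have "2 * (c1 * a + c2 * a\<^sup>2) + 2 * (c2 * a\<^sup>2) = 0" by (simp add: algebra_simps power2_eq_square)
  then have "c2 = 0" using 1 a by simp
  then show ?thesis using 1 a by simp
qed

text \<open>
  Periodicity extends \<open>Q\<close> to an entire function. Moving a point \<open>w\<close> into the period strip
  multiplies \<open>1 + cmod w\<close> at most by a constant, so the extension inherits quadratic growth; by
  Liouville's theorem it is a quadratic polynomial, and a periodic polynomial is constant.
\<close>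
lemma half_plane_periodic_constant:
  fixes a :: complex
  assumes a: "Re a > 0" and hol: "Q holomorphic_on {w. Re w > 0}"
    and per: "\<And>w. Re w > 0 \<Longrightarrow> Q (w + a) = Q w"
    and bound: "\<And>w. 1 \<le> Re w \<Longrightarrow> Re w \<le> 1 + Re a \<Longrightarrow> cmod (Q w) \<le> B * (1 + cmod w)\<^sup>2"
  shows "\<exists>c. \<forall>w. Re w > 0 \<longrightarrow> Q w = c"
proof -
  have per_n: "Q (w + of_nat n * a) = Q w" if "Re w > 0" for w n
    by (rule half_plane_periodic_nat) (use per a that in auto)
  \<comment> \<open>The number of periods that moves \<open>w\<close> into the strip of the growth bound.\<close>
  define shift where "shift w = \<lceil>(1 - Re w) / Re a\<rceil>" for w
  define E where "E w = Q (w + of_nat (nat (shift w)) * a)" for w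
  have shift: "1 \<le> Re w + of_int (shift w) * Re a" "Re w + of_int (shift w) * Re a \<le> 1 + Re a" for w
  proof -
    have "(1 - Re w) / Re a \<le> of_int (shift w)" "of_int (shift w) \<le> (1 - Re w) / Re a + 1"
      unfolding shift_def by linarith+
    then show "1 \<le> Re w + of_int (shift w) * Re a" "Re w + of_int (shift w) * Re a \<le> 1 + Re a"
      using a by (simp_all add: field_simps)
  qed
  have shift_pos: "Re (w + of_nat (nat (shift w)) * a) > 0" for w
  proof -
    have "of_int (shift w) * Re a \<le> of_nat (nat (shift w)) * Re a"
      using a by (intro mult_right_mono) auto
    then show ?thesis using shift(1)[of w] by simp
  qed
  have E_eq: "E w = Q (w + of_nat n * a)" if n: "Re (w + of_nat n * a) > 0" for w n
  proof (cases "n \<le> nat (shift w)")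
    case True
    then have "w + of_nat (nat (shift w)) * a = (w + of_nat n * a) + of_nat (nat (shift w) - n) * a"
      by (simp add: algebra_simps of_nat_diff)
    then show ?thesis unfolding E_def using per_n[OF n] by metis
  next
    case False
    then have "w + of_nat n * a = (w + of_nat (nat (shift w)) * a) + of_nat (n - nat (shift w)) * a"
      by (simp add: algebra_simps of_nat_diff)
    then show ?thesis unfolding E_def using per_n[OF shift_pos] by metis
  qed
  have E_hol: "E holomorphic_on UNIV"
    unfolding holomorphic_on_def
  proof
    fix w0
    obtain n where n: "(1 - Re w0) / Re a < real n" using reals_Archimedean2 by blast
    have pos: "Re (w + of_nat n * a) > 0" if "w \<in> ball w0 1" for w
    proof -
      have "\<bar>Re (w0 - w)\<bar> \<le> cmod (w0 - w)" by (rule abs_Re_le_cmod)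
      also have "\<dots> < 1" using that by (simp add: dist_norm)
      finally have "Re w0 - 1 < Re w" by auto
      moreover have "1 - Re w0 < real n * Re a" using n a by (simp add: field_simps)
      ultimately show ?thesis by simp
    qed
    have "(\<lambda>w. Q (w + of_nat n * a)) holomorphic_on ball w0 1"
      by (rule holomorphic_on_compose_gen[OF _ hol, unfolded o_def])
         (use pos in \<open>auto intro!: holomorphic_intros\<close>)
    then have "E holomorphic_on ball w0 1"
      by (rule holomorphic_transform) (use E_eq pos in metis)
    then have "E field_differentiable at w0"
      by (rule holomorphic_on_imp_differentiable_at) auto
    then show "E field_differentiable at w0 within UNIV" by simp
  qed
  have "0 \<le> B * (1 + cmod 1)\<^sup>2"
    using bound[of 1] a norm_ge_zero[of "Q 1"] by (smt (verit) one_complex.simps(1))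
  then have B: "0 \<le> B" by (simp add: zero_le_mult_iff)
  \<comment> \<open>The shift is at most \<open>(1 / Re a + 1) * (1 + cmod w)\<close> periods long.\<close>
  define k where "k = 1 + (1 / Re a + 1) * cmod a"
  have k: "1 \<le> k" using a by (simp add: k_def)
  have E_bound: "cmod (E w) \<le> B * (k * (1 + cmod w))\<^sup>2" for w
  proof -
    define v where "v = w + of_int (shift w) * a"
    have v: "1 \<le> Re v" "Re v \<le> 1 + Re a" using shift[of w] by (auto simp: v_def)
    have "E w = Q v"
    proof (cases "shift w \<ge> 0")
      case True
      then show ?thesis by (simp add: E_def v_def)
    next
      case False
      then have w: "w = v + of_nat (nat (- shift w)) * a" by (simp add: v_def)
      have "of_int (shift w) * Re a \<le> 0"
        using a False by (intro mult_nonpos_nonneg) auto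
      then have "Re w > 0"
        using v by (simp add: v_def)
      then have "E w = Q w" using E_eq[of w 0] by simp
      also have "\<dots> = Q v" using v by (subst w, intro per_n) auto
      finally show ?thesis .
    qed
    have "\<bar>of_int (shift w)\<bar> \<le> \<bar>(1 - Re w) / Re a\<bar> + 1"
      unfolding shift_def by linarith
    also have "\<bar>(1 - Re w) / Re a\<bar> = \<bar>1 - Re w\<bar> / Re a" using a by simp
    also have "\<dots> \<le> (1 + cmod w) / Re a"
      using a abs_Re_le_cmod[of w] by (intro divide_right_mono) auto
    also have "\<dots> + 1 \<le> (1 / Re a + 1) * (1 + cmod w)" by (simp add: algebra_simps add_divide_distrib)
    finally have m: "\<bar>of_int (shift w)\<bar> \<le> (1 / Re a + 1) * (1 + cmod w)" by simp
    have "cmod v \<le> cmod w + \<bar>of_int (shift w)\<bar> * cmod a"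
      unfolding v_def by (metis norm_mult norm_of_int norm_triangle_ineq)
    also have "\<dots> \<le> cmod w + (1 / Re a + 1) * (1 + cmod w) * cmod a"
      by (intro add_left_mono mult_right_mono m) auto
    finally have "1 + cmod v \<le> k * (1 + cmod w)" by (simp add: k_def algebra_simps)
    then have "B * (1 + cmod v)\<^sup>2 \<le> B * (k * (1 + cmod w))\<^sup>2"
      using B by (intro mult_left_mono power_mono) auto
    then show ?thesis using bound[OF v] \<open>E w = Q v\<close> by simp
  qed
  have "cmod (E w) \<le> (4 * B * k\<^sup>2) * cmod w ^ 2" if "1 \<le> cmod w" for w
  proof -
    have "B * (k * (1 + cmod w))\<^sup>2 \<le> B * (k * (2 * cmod w))\<^sup>2"
      using B k that by (intro mult_left_mono power_mono) auto
    then show ?thesis using E_bound[of w] by (simp add: power_mult_distrib mult_ac)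
  qed
  from Liouville_polynomial[OF E_hol this]
  obtain C where C: "\<And>w. E w = (\<Sum>j\<le>2. C j * w ^ j)" by metis
  have quad: "E w = C 0 + C 1 * w + C 2 * w\<^sup>2" for w
    by (simp add: C numeral_2_eq_2)
  have "E 0 = Q a" "E a = Q a" using E_eq[of 0 1] E_eq[of a 0] a by auto
  moreover have "E (2 * a) = Q a"
    using E_eq[of "2 * a" 0] per_n[of a 1] a by simp
  ultimately have "C 1 = 0 \<and> C 2 = 0"
    using a by (intro quadratic_periodic_const[of E "C 0" "C 1" "C 2" a] quad) auto
  then have E_const: "E w = C 0" for w using quad[of w] by simp
  have "Q w = C 0" if "Re w > 0" for w
    using E_eq[of w 0] that by (simp add: E_const)
  then show ?thesis by blast
qed

section \<open>Parabolic maps in half-plane coordinates\<close>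

context punctured_circle
begin

text \<open>
  Radial approach stays inside the set on which \<open>h\<close> is continuous.
\<close>
lemma radial_limit:
  assumes cont: "continuous_on (cball 0 1 - {\<alpha>}) h" and z: "z \<in> cball 0 1 - {\<alpha>}"
  shows "(\<lambda>n. h (of_real (radius n) * z)) \<longlonglongrightarrow> h z"
proof (rule continuous_on_tendsto_compose[OF cont _ z])
  have "(\<lambda>n. of_real (radius n) * z) \<longlonglongrightarrow> of_real 1 * z"
    by (intro tendsto_mult tendsto_const tendsto_of_real radius_tendsto)
  then show "(\<lambda>n. of_real (radius n) * z) \<longlonglongrightarrow> z" by simp
  have "of_real (radius n) * z \<in> cball 0 1 - {\<alpha>}" for n
    using radius_cball[of z n] z norm_\<alpha> by (auto intro: less_imp_le)
  then show "\<forall>\<^sub>F n in sequentially. of_real (radius n) * z \<in> cball 0 1 - {\<alpha>}"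
    by (intro always_eventually allI)
qed

definition cayley :: "complex \<Rightarrow> complex" where
  "cayley z = (\<alpha> + z) / (\<alpha> - z)"

definition inv_cayley :: "complex \<Rightarrow> complex" where
  "inv_cayley w = \<alpha> * (w - 1) / (w + 1)"

lemma \<alpha>_nz: "\<alpha> \<noteq> 0" using norm_\<alpha> by auto

lemma disc_ne_\<alpha>: "z \<in> \<D> \<Longrightarrow> z \<noteq> \<alpha>" using norm_\<alpha> by auto

lemma cayley_plus_1: "z \<noteq> \<alpha> \<Longrightarrow> cayley z + 1 = 2 * \<alpha> / (\<alpha> - z)"
  by (simp add: cayley_def field_simps)

lemma inv_cayley_cayley: "z \<noteq> \<alpha> \<Longrightarrow> inv_cayley (cayley z) = z"
  using \<alpha>_nz by (simp add: inv_cayley_def cayley_plus_1) (simp add: cayley_def field_simps)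

lemma \<alpha>_minus_inv_cayley: "w \<noteq> -1 \<Longrightarrow> \<alpha> - inv_cayley w = 2 * \<alpha> / (w + 1)"
  by (simp add: inv_cayley_def field_simps add_eq_0_iff)

lemma cayley_inv_cayley:
  assumes "w \<noteq> -1"
  shows "cayley (inv_cayley w) = w"
proof -
  have w: "w + 1 \<noteq> 0" using assms by (simp add: add_eq_0_iff2)
  then have "\<alpha> + inv_cayley w = 2 * \<alpha> * w / (w + 1)"
    by (simp add: inv_cayley_def field_simps)
  then show ?thesis
    using w \<alpha>_nz by (simp add: cayley_def \<alpha>_minus_inv_cayley[OF assms])
qed

lemma Re_cayley: "Re (cayley z) = (1 - (cmod z)\<^sup>2) / (cmod (\<alpha> - z))\<^sup>2"
  using poisson_eq_Re[OF norm_\<alpha>, of z] by (simp add: cayley_def poisson_def)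

lemma Re_cayley_pos: "z \<in> \<D> \<Longrightarrow> 0 < Re (cayley z)"
  using disc_ne_\<alpha>[of z] by (simp add: Re_cayley power_less_one_iff abs_square_less_1)

lemma Re_cayley_nonneg: "z \<in> cball 0 1 \<Longrightarrow> 0 \<le> Re (cayley z)"
  by (simp add: Re_cayley power_le_one)

lemma one_minus_norm_sq:
  assumes "w \<noteq> -1"
  shows "1 - (cmod (inv_cayley w))\<^sup>2 = 4 * Re w / (cmod (w + 1))\<^sup>2"
proof -
  have w: "w + 1 \<noteq> 0" using assms by (simp add: add_eq_0_iff2)
  have "Re w = (1 - (cmod (inv_cayley w))\<^sup>2) / (cmod (2 * \<alpha> / (w + 1)))\<^sup>2"
    using Re_cayley[of "inv_cayley w"] by (simp add: cayley_inv_cayley \<alpha>_minus_inv_cayley assms)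
  also have "\<dots> = (1 - (cmod (inv_cayley w))\<^sup>2) * (cmod (w + 1))\<^sup>2 / 4"
    by (simp add: norm_divide norm_mult norm_\<alpha> power_divide)
  finally show ?thesis using w by (simp add: field_simps)
qed

lemma right_half_plane_ne: "0 \<le> Re w \<Longrightarrow> w \<noteq> -1"
  by auto

lemma inv_cayley_disc:
  assumes "0 < Re w"
  shows "inv_cayley w \<in> \<D>"
proof -
  have "w \<noteq> -1" using assms by (intro right_half_plane_ne) auto
  moreover from this have "w + 1 \<noteq> 0" by (simp add: add_eq_0_iff2)
  ultimately have "0 < 1 - (cmod (inv_cayley w))\<^sup>2"
    using one_minus_norm_sq[of w] assms by simp
  then show ?thesis by (simp add: abs_square_less_1)
qed

text \<open>
  In half-plane coordinates \<open>1 - (cmod z)\<^sup>2\<close> equals \<open>4 * Re w / (cmod (w + 1))\<^sup>2\<close>, so the bound for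
  point evaluations becomes polynomial growth on every half-plane \<open>Re w \<ge> \<rho>\<close>. The estimate
  \<open>x \<le> 1 + x powr p\<close> removes the root.
\<close>
lemma hardy_growth:
  assumes g: "g \<in> hardy_space p" and \<rho>: "0 < \<rho>" "\<rho> \<le> Re w"
  shows "cmod (g (inv_cayley w)) \<le> 1 + hardy_sup p g * (cmod (w + 1))\<^sup>2 / (2 * \<rho>)"
proof -
  let ?z = "inv_cayley w" and ?S = "hardy_sup p g"
  have z: "?z \<in> \<D>" using \<rho> by (intro inv_cayley_disc) auto
  have ne: "w \<noteq> -1" using \<rho> by (intro right_half_plane_ne) auto
  then have "w + 1 \<noteq> 0" by (simp add: add_eq_0_iff2)
  then have w1: "0 < (cmod (w + 1))\<^sup>2" by simp
  have n: "cmod ?z < 1" using z by simp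
  have "4 * \<rho> / (cmod (w + 1))\<^sup>2 \<le> 4 * Re w / (cmod (w + 1))\<^sup>2"
    using \<rho> by (intro divide_right_mono) auto
  also have "\<dots> = (1 + cmod ?z) * (1 - cmod ?z)"
    using one_minus_norm_sq[OF ne] by (simp add: power2_eq_square algebra_simps)
  also have "\<dots> \<le> 2 * (1 - cmod ?z)" using n by (intro mult_right_mono) auto
  finally have low: "2 * \<rho> / (cmod (w + 1))\<^sup>2 \<le> 1 - cmod ?z" by simp
  have "cmod (g ?z) \<le> 1 + cmod (g ?z) powr p"
    using p by (intro le_one_plus_powr) auto
  also have "cmod (g ?z) powr p \<le> ?S / (1 - cmod ?z)"
    by (rule point_evaluation_bound[OF g z])
  also have "\<dots> \<le> ?S / (2 * \<rho> / (cmod (w + 1))\<^sup>2)"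
    using low hardy_sup_nonneg[OF g] n \<rho> w1
    by (intro divide_left_mono mult_pos_pos divide_pos_pos) auto
  finally show ?thesis by simp
qed

lemma cayley_holomorphic: "cayley holomorphic_on - {\<alpha>}"
  unfolding cayley_def by (intro holomorphic_intros) auto

lemma inv_cayley_holomorphic: "inv_cayley holomorphic_on {w. 0 < Re w}"
  unfolding inv_cayley_def by (intro holomorphic_intros) (auto simp: complex_eq_iff)

text \<open>The eigenfunctions of every parabolic composition operator fixing \<open>\<alpha>\<close>.\<close>
definition inner_exp :: "real \<Rightarrow> complex \<Rightarrow> complex" where
  "inner_exp s z = exp (- (of_real s * cayley z))"

lemma norm_inner_exp_le:
  assumes "0 \<le> s" "z \<in> cball 0 1"
  shows "cmod (inner_exp s z) \<le> 1"
  using Re_cayley_nonneg[OF assms(2)] assms(1) by (simp add: inner_exp_def)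

lemma inner_exp_holomorphic: "inner_exp s holomorphic_on - {\<alpha>}"
  unfolding inner_exp_def by (intro holomorphic_intros cayley_holomorphic)

lemma mildI_bounded:
  assumes "h holomorphic_on \<D>" "continuous_on (cball 0 1 - {\<alpha>}) h"
    and B: "\<And>z. z \<in> cball 0 1 - {\<alpha>} \<Longrightarrow> cmod (h z) \<le> B"
  shows "mild h"
  unfolding mild_def
proof (intro conjI exI ballI assms)
  fix z assume z: "z \<in> cball 0 1 - {\<alpha>}"
  have "cmod (\<alpha> - z) \<le> 2"
    using norm_triangle_ineq4[of \<alpha> z] z norm_\<alpha> by simp
  then have "(cmod (\<alpha> - z))\<^sup>2 \<le> 2\<^sup>2" by (intro power_mono) auto
  then show "cmod (h z) * (cmod (\<alpha> - z))\<^sup>2 \<le> B * 2\<^sup>2"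
    using B[OF z] by (intro mult_mono) (auto intro: order_trans[OF norm_ge_zero])
qed

lemma mild_inner_exp: "0 \<le> s \<Longrightarrow> mild (inner_exp s)"
  by (rule mildI_bounded[of _ 1])
     (auto intro!: norm_inner_exp_le holomorphic_on_subset[OF inner_exp_holomorphic]
        holomorphic_on_imp_continuous_on simp: norm_\<alpha>)

lemma punct_cis: "t \<in> punct \<Longrightarrow> cis t \<in> cball 0 1 - {\<alpha>}"
  by (simp add: punct_def)

lemma circ_pow_bounded:
  assumes "\<And>z. z \<in> cball 0 1 - {\<alpha>} \<Longrightarrow> cmod (h z) \<le> B"
  shows "circ_pow h < \<infinity>"
  by (rule circ_pow_dominated[of _ "\<lambda>_. B"], rule assms, erule punct_cis,
      rule nn_integral_circ_const)

lemma inner_exp_in_space: "0 \<le> s \<Longrightarrow> cut (inner_exp s) \<in> hardy_space p"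
  by (intro mild_in_hardy_space mild_inner_exp circ_pow_bounded[of _ 1] norm_inner_exp_le) auto

end

locale parabolic_map = punctured_circle +
  fixes a :: complex
  assumes Re_a: "0 < Re a"
begin

definition par :: "complex \<Rightarrow> complex" where
  "par z = inv_cayley (cayley z + a)"

lemma cayley_plus_a_pos:
  assumes "z \<in> cball 0 1"
  shows "0 < Re (cayley z + a)"
  using Re_cayley_nonneg[OF assms] Re_a by simp

lemma par_disc: "z \<in> cball 0 1 \<Longrightarrow> par z \<in> \<D>"
  unfolding par_def by (intro inv_cayley_disc cayley_plus_a_pos)

lemma cayley_par: "z \<in> cball 0 1 \<Longrightarrow> cayley (par z) = cayley z + a"
  unfolding par_def using cayley_plus_a_pos[of z]
  by (intro cayley_inv_cayley right_half_plane_ne) auto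

lemma par_holomorphic: "par holomorphic_on \<D>"
proof -
  have "inv_cayley \<circ> (\<lambda>z. cayley z + a) holomorphic_on \<D>"
    by (rule holomorphic_on_compose_gen[OF _ inv_cayley_holomorphic])
       (use cayley_plus_a_pos norm_\<alpha> in
         \<open>auto intro!: holomorphic_intros holomorphic_on_subset[OF cayley_holomorphic]\<close>)
  then show ?thesis by (simp add: par_def[abs_def] o_def)
qed

lemma par_continuous: "continuous_on (cball 0 1 - {\<alpha>}) par"
  unfolding par_def
  by (rule continuous_on_compose2[OF holomorphic_on_imp_continuous_on[OF inv_cayley_holomorphic]])
     (use cayley_plus_a_pos in
         \<open>auto intro!: continuous_intros continuous_on_subset[OF holomorphic_on_imp_continuous_on[OF cayley_holomorphic]]\<close>)

lemma par_image: "par ` \<D> \<subseteq> \<D>"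
  using par_disc by auto

lemma comp_op_inner_exp:
  "comp_op par (cut (inner_exp s)) = (\<lambda>z. exp (- (of_real s * a)) * cut (inner_exp s) z)"
  using par_disc by (auto simp: comp_op_def cut_def inner_exp_def cayley_par algebra_simps fun_eq_iff
      simp flip: exp_add)

text \<open>
  In the half-plane, an eigenfunction divided by the exponential is \<open>a\<close>-periodic, and the growth
  bound for Hardy functions is polynomial on a period strip.
\<close>
lemma eigenfunction:
  assumes g: "g \<in> hardy_space p" and s: "0 \<le> s"
    and eigen_eq: "comp_op par g = (\<lambda>z. exp (- (of_real s * a)) * g z)"
  shows "\<exists>c. g = (\<lambda>z. c * cut (inner_exp s) z)"
proof -
  let ?S = "hardy_sup p g"
  have hol: "g holomorphic_on \<D>" and zero: "\<And>z. z \<notin> \<D> \<Longrightarrow> g z = 0"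
    using g by (auto simp: hardy_space_def)
  have S: "0 \<le> ?S" by (rule hardy_sup_nonneg[OF g])
  define Q where "Q w = exp (of_real s * w) * g (inv_cayley w)" for w
  have "\<exists>c. \<forall>w. Re w > 0 \<longrightarrow> Q w = c"
  proof (rule half_plane_periodic_constant[OF Re_a])
    have "g \<circ> inv_cayley holomorphic_on {w. 0 < Re w}"
      by (rule holomorphic_on_compose_gen[OF inv_cayley_holomorphic hol]) (auto intro: inv_cayley_disc)
    then show "Q holomorphic_on {w. 0 < Re w}"
      unfolding Q_def o_def by (intro holomorphic_intros)
  next
    fix w assume w: "0 < Re w"
    let ?z = "inv_cayley w"
    have z: "?z \<in> \<D>" by (rule inv_cayley_disc[OF w])
    have "cayley ?z = w" using w by (intro cayley_inv_cayley right_half_plane_ne) auto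
    then have "par ?z = inv_cayley (w + a)" by (simp add: par_def)
    then have "g (inv_cayley (w + a)) = exp (- (of_real s * a)) * g ?z"
      using fun_cong[OF eigen_eq, of ?z] z by (simp add: comp_op_def)
    then show "Q (w + a) = Q w"
      by (simp add: Q_def algebra_simps flip: exp_add mult.assoc)
  next
    fix w assume w: "1 \<le> Re w" "Re w \<le> 1 + Re a"
    let ?z = "inv_cayley w"
    have "cmod (g ?z) \<le> 1 + ?S * (cmod (w + 1))\<^sup>2 / (2 * 1)"
      using w by (intro hardy_growth g) auto
    also have "\<dots> \<le> 1 + ?S * (cmod (w + 1))\<^sup>2"
      using S by simp
    also have "\<dots> \<le> 1 + ?S * (1 + cmod w)\<^sup>2"
      using S norm_triangle_ineq[of w 1] by (intro add_left_mono mult_left_mono power_mono) auto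
    also have "\<dots> \<le> (1 + ?S) * (1 + cmod w)\<^sup>2"
      using one_le_power[of "1 + cmod w" 2] by (simp add: algebra_simps)
    finally have gz: "cmod (g ?z) \<le> (1 + ?S) * (1 + cmod w)\<^sup>2" .
    have "cmod (Q w) = exp (s * Re w) * cmod (g ?z)" by (simp add: Q_def norm_mult)
    also have "\<dots> \<le> exp (s * (1 + Re a)) * ((1 + ?S) * (1 + cmod w)\<^sup>2)"
      using w s by (intro mult_mono gz) (auto intro!: mult_left_mono)
    finally show "cmod (Q w) \<le> (exp (s * (1 + Re a)) * (1 + ?S)) * (1 + cmod w)\<^sup>2"
      by (simp add: mult.assoc)
  qed
  then obtain c where c: "\<And>w. Re w > 0 \<Longrightarrow> Q w = c" by blast
  have "g z = c * cut (inner_exp s) z" for z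
  proof (cases "z \<in> \<D>")
    case True
    have "Q (cayley z) = c" by (rule c[OF Re_cayley_pos[OF True]])
    then have "exp (of_real s * cayley z) * g z = c"
      using disc_ne_\<alpha>[OF True] by (simp add: Q_def inv_cayley_cayley)
    then have "g z = c / exp (of_real s * cayley z)"
      by (simp add: field_simps)
    then show ?thesis
      using True by (simp add: cut_def inner_exp_def exp_minus divide_inverse)
  qed (simp add: zero cut_def)
  then show ?thesis by blast
qed

end

section \<open>Riemann sums for the Laplace transform\<close>

text \<open>
  The modulus of the ratio is at most \<open>exp (- 1 / N)\<close>, so the bound is uniform in \<open>y\<close>, in the number
  of summands and in the mesh \<open>1 / N\<close>.
\<close>
lemma geometric_laplace_bound:
  fixes y :: complex
  assumes y: "1 \<le> Re y" and N: "1 \<le> N"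
  shows "cmod (of_real (1 / N) * (\<Sum>k<m. exp (- y / of_real N) ^ k)) \<le> 2"
proof -
  define \<rho> where "\<rho> = exp (- (1 / N))"
  have \<rho>: "0 \<le> \<rho>" "\<rho> < 1" using N by (auto simp: \<rho>_def)
  have q: "cmod (exp (- y / of_real N)) \<le> \<rho>"
    using y N by (simp add: \<rho>_def divide_right_mono)
  have "1 + 1 / N \<le> exp (1 / N)" by (rule exp_ge_add_one_self)
  then have "\<rho> \<le> 1 / (1 + 1 / N)"
    unfolding \<rho>_def exp_minus inverse_eq_divide using N by (intro divide_left_mono) (auto simp: add_pos_pos)
  then have r: "1 / (N + 1) \<le> 1 - \<rho>" using N by (simp add: field_simps)
  have "cmod (\<Sum>k<m. exp (- y / of_real N) ^ k) \<le> (\<Sum>k<m. \<rho> ^ k)"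
    by (rule order_trans[OF norm_sum], intro sum_mono) (simp only: norm_power power_mono[OF q norm_ge_zero])
  also have "\<dots> \<le> 1 / (1 - \<rho>)"
    using \<rho> by (simp add: sum_gp_strict divide_right_mono)
  also have "\<dots> \<le> 1 / (1 / (N + 1))"
    using r \<rho> N by (intro divide_left_mono) auto
  also have "\<dots> \<le> 2 * N" using N by simp
  finally show ?thesis
    using N by (simp add: norm_mult norm_divide field_simps)
qed

text \<open>
  The sums discretise \<open>\<integral> exp (- s y) ds\<close> over \<open>[0, n + 1]\<close> with mesh \<open>1 / (n + 1)\<close>; both the
  truncation and the mesh are refined by the one parameter \<open>n\<close>. Summing the geometric series replaces
  the integral by the derivative of \<open>exp\<close> at \<open>0\<close>.
\<close>
lemma geometric_laplace_tendsto:
  fixes y :: complex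
  assumes y: "1 \<le> Re y"
  shows "(\<lambda>n. of_real (1 / real (Suc n)) * (\<Sum>k<(Suc n)\<^sup>2. exp (- y / of_real (real (Suc n))) ^ k))
    \<longlonglongrightarrow> 1 / y"
proof -
  define N where "N n = real (Suc n)" for n
  have N: "0 < N n" for n by (simp add: N_def)
  have y0: "y \<noteq> 0" using y by auto
  let ?h = "\<lambda>n. - y / of_real (N n)"
  have h0: "?h \<longlonglongrightarrow> 0"
  proof -
    have "(\<lambda>n. - y * of_real (inverse (real (Suc n)))) \<longlonglongrightarrow> - y * of_real 0"
      by (intro tendsto_mult tendsto_const tendsto_of_real LIMSEQ_inverse_real_of_nat)
    then show ?thesis by (simp add: N_def divide_inverse of_real_inverse del: of_nat_Suc)
  qed
  have "filterlim ?h (at 0) sequentially"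
    using h0 y0 N by (auto simp: filterlim_at less_imp_neq[THEN not_sym])
  from filterlim_compose[OF lim_exp_minus_1 this]
  have "(\<lambda>n. (exp (?h n) - 1) / ?h n) \<longlonglongrightarrow> 1" .
  then have "(\<lambda>n. y * ((exp (?h n) - 1) / ?h n)) \<longlonglongrightarrow> y * 1"
    by (intro tendsto_intros)
  moreover have "y * ((exp (?h n) - 1) / ?h n) = of_real (N n) * (1 - exp (?h n))" for n
  proof -
    have "y / ?h n = - of_real (N n)" using y0 by simp
    then have "y * ((exp (?h n) - 1) / ?h n) = - of_real (N n) * (exp (?h n) - 1)"
      by (metis times_divide_eq_left times_divide_eq_right mult.commute)
    then show ?thesis by (simp add: algebra_simps)
  qed
  ultimately have den: "(\<lambda>n. of_real (N n) * (1 - exp (?h n))) \<longlonglongrightarrow> y"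
    by simp
  have q_pow: "exp (?h n) ^ (Suc n)\<^sup>2 = exp (- y * of_real (N n))" for n
  proof -
    have "exp (?h n) ^ (Suc n)\<^sup>2 = exp (of_nat ((Suc n)\<^sup>2) * ?h n)"
      by (rule exp_of_nat_mult[symmetric])
    also have "of_nat ((Suc n)\<^sup>2) = (of_real (N n))\<^sup>2"
      unfolding N_def by (simp only: of_nat_power of_real_of_nat_eq)
    also have "(of_real (N n))\<^sup>2 * ?h n = - y * of_real (N n)"
      using N[of n] by (simp add: power2_eq_square)
    finally show ?thesis .
  qed
  have num: "(\<lambda>n. exp (- y * of_real (N n))) \<longlonglongrightarrow> 0"
  proof (rule Lim_null_comparison)
    have "exp (- (Re y * N n)) \<le> inverse (real (Suc n))" for n
    proof -
      have "N n \<le> Re y * N n" using y N[of n] by simp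
      also have "\<dots> \<le> exp (Re y * N n)" using exp_ge_add_one_self[of "Re y * N n"] by linarith
      finally show ?thesis
        using N[of n] by (simp add: exp_minus N_def le_imp_inverse_le)
    qed
    then show "\<forall>\<^sub>F n in sequentially. cmod (exp (- y * of_real (N n))) \<le> inverse (real (Suc n))"
      by (intro always_eventually) simp
    show "(\<lambda>n. inverse (real (Suc n))) \<longlonglongrightarrow> 0" by (rule LIMSEQ_inverse_real_of_nat)
  qed
  have ne: "exp (?h n) \<noteq> 1" for n
  proof
    assume "exp (?h n) = 1"
    then have "exp (Re (?h n)) = 1" by (metis norm_exp_eq_Re norm_one)
    then show False using y N[of n] by simp
  qed
  have "(\<lambda>n. (1 - exp (- y * of_real (N n))) / (of_real (N n) * (1 - exp (?h n)))) \<longlonglongrightarrow> (1 - 0) / y"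
    by (intro tendsto_intros num den y0)
  moreover have "of_real (1 / N n) * (\<Sum>k<(Suc n)\<^sup>2. exp (?h n) ^ k)
      = (1 - exp (- y * of_real (N n))) / (of_real (N n) * (1 - exp (?h n)))" for n
    using ne[of n] by (simp only: sum_gp_strict q_pow) simp
  ultimately show ?thesis by (simp add: N_def)
qed

section \<open>Operators that act on the eigenfunctions as a scalar\<close>

locale scalar_on_exp = parabolic_map +
  fixes J :: "(complex \<Rightarrow> complex) \<Rightarrow> complex \<Rightarrow> complex" and c :: complex
  assumes J: "J \<in> hardy_ops p"
    and J_exp: "\<And>s. 0 \<le> s \<Longrightarrow> J (cut (inner_exp s)) = (\<lambda>z. c * cut (inner_exp s) z)"
begin

text \<open>
  Membership in the eigenspace of \<open>J\<close> for \<open>c\<close>, for functions given on the closed disc without \<open>\<alpha>\<close>.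
\<close>
definition eigen :: "(complex \<Rightarrow> complex) \<Rightarrow> bool" where
  "eigen h \<longleftrightarrow> mild h \<and> cut h \<in> hardy_space p \<and> (\<forall>z\<in>\<D>. J (cut h) z = c * h z)"

text \<open>
  The eigenspace is closed under dominated convergence on the circle. The limit is also required
  inside the disc, where it identifies the right-hand side \<open>c * h z\<close>.
\<close>
lemma eigen_dominated_convergence:
  assumes hs: "\<And>n. eigen (hs n)" and h: "mild h"
    and "k \<in> borel_measurable circ" and fin: "(\<integral>\<^sup>+t. ennreal (k t powr p) \<partial>circ) < \<infinity>"
    and dom: "\<And>n t. t \<in> punct \<Longrightarrow> cmod (hs n (cis t)) \<le> k t"
    and lim: "\<And>z. z \<in> cball 0 1 - {\<alpha>} \<Longrightarrow> (\<lambda>n. hs n z) \<longlonglongrightarrow> h z"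
  shows "eigen h"
  unfolding eigen_def
proof (intro conjI ballI h)
  have "cmod (h (cis t)) \<le> k t" if "t \<in> punct" for t
    by (rule LIMSEQ_le_const2[OF tendsto_norm[OF lim[OF punct_cis[OF that]]]])
       (use dom[OF that] in blast)
  then have "circ_pow h < \<infinity>" by (rule circ_pow_dominated[OF _ fin])
  then show "cut h \<in> hardy_space p" by (rule mild_in_hardy_space(1)[OF h])
  fix z assume z: "z \<in> \<D>"
  have "(\<lambda>n. J (cut (hs n)) z) \<longlonglongrightarrow> J (cut h) z"
    using hs by (intro hardy_op_dominated_convergence[OF J _ h assms(3) fin dom lim[OF punct_cis] z])
      (auto simp: eigen_def)
  moreover have "(\<lambda>n. J (cut (hs n)) z) \<longlonglongrightarrow> c * h z"
  proof -
    have "(\<lambda>n. c * hs n z) \<longlonglongrightarrow> c * h z"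
      using z disc_ne_\<alpha>[OF z] by (intro tendsto_intros lim) auto
    then show ?thesis using hs z by (simp add: eigen_def)
  qed
  ultimately show "J (cut h) z = c * h z" by (rule LIMSEQ_unique)
qed

lemma eigen_bounded_convergence:
  assumes hs: "\<And>n. eigen (hs n)" and "h holomorphic_on \<D>" "continuous_on (cball 0 1 - {\<alpha>}) h"
    and B: "\<And>n z. z \<in> cball 0 1 - {\<alpha>} \<Longrightarrow> cmod (hs n z) \<le> B"
    and lim: "\<And>z. z \<in> cball 0 1 - {\<alpha>} \<Longrightarrow> (\<lambda>n. hs n z) \<longlonglongrightarrow> h z"
  shows "eigen h"
proof (rule eigen_dominated_convergence[OF hs _ _ nn_integral_circ_const _ lim])
  have "cmod (h z) \<le> B" if "z \<in> cball 0 1 - {\<alpha>}" for z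
    by (rule LIMSEQ_le_const2[OF tendsto_norm[OF lim[OF that]]]) (use B[OF that] in blast)
  then show "mild h" by (rule mildI_bounded[OF assms(2,3)])
  show "(\<lambda>_. B) \<in> borel_measurable circ" by simp
  show "cmod (hs n (cis t)) \<le> B" if "t \<in> punct" for n t
    by (rule B[OF punct_cis[OF that]])
qed

lemma eigen_inner_exp:
  assumes "0 \<le> s"
  shows "eigen (inner_exp s)"
  unfolding eigen_def J_exp[OF assms]
  using assms by (simp add: mild_inner_exp inner_exp_in_space) (simp add: cut_def)

lemma eigen_cmult:
  assumes "eigen h"
  shows "eigen (\<lambda>z. b * h z)"
proof -
  have eq: "cut (\<lambda>z. b * h z) = (\<lambda>z. b * cut h z)" by (auto simp: cut_def)
  have sp: "cut h \<in> hardy_space p" using assms by (simp add: eigen_def)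
  have "cut (\<lambda>z. b * h z) \<in> hardy_space p"
  proof (rule hardy_spaceI(1)[of _ _ "cmod b powr p * hardy_sup p (cut h)"])
    show "cut (\<lambda>z. b * h z) holomorphic_on \<D>"
      using sp unfolding eq by (auto simp: hardy_space_def intro!: holomorphic_intros)
    show "hardy_integral p (cut (\<lambda>z. b * h z)) r \<le> cmod b powr p * hardy_sup p (cut h)"
      if "0 < r" "r < 1" for r
    proof -
      have "hardy_integral p (cut (\<lambda>z. b * h z)) r = cmod b powr p * hardy_integral p (cut h) r"
        by (simp add: eq hardy_integral_def norm_mult powr_mult)
      then show ?thesis
        using that by (simp add: mult_left_mono hardy_integral_le_sup[OF sp])
    qed
  qed (simp add: cut_def)
  moreover have "J (cut (\<lambda>z. b * h z)) = (\<lambda>z. b * J (cut h) z)"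
    using J sp by (simp add: eq hardy_ops_def)
  ultimately show ?thesis
    using assms by (simp add: eigen_def mild_cmult)
qed

lemma eigen_add:
  assumes g: "eigen g" and h: "eigen h" and "bounded (g ` cball 0 1)" "bounded (h ` cball 0 1)"
  shows "eigen (\<lambda>z. g z + h z)"
proof -
  obtain A B where A: "\<And>z. z \<in> cball 0 1 \<Longrightarrow> cmod (g z) \<le> A" and B: "\<And>z. z \<in> cball 0 1 \<Longrightarrow> cmod (h z) \<le> B"
    using assms(3,4) unfolding bounded_iff by blast
  have m: "mild (\<lambda>z. g z + h z)" using g h by (simp add: eigen_def mild_add)
  have "cmod (g z + h z) \<le> A + B" if "z \<in> cball 0 1 - {\<alpha>}" for z
    using norm_triangle_ineq[of "g z" "h z"] A[of z] B[of z] that by auto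
  then have "cut (\<lambda>z. g z + h z) \<in> hardy_space p"
    by (intro mild_in_hardy_space(1)[OF m] circ_pow_bounded)
  moreover have "cut (\<lambda>z. g z + h z) = (\<lambda>z. cut g z + cut h z)" by (auto simp: cut_def)
  moreover have "J (\<lambda>z. cut g z + cut h z) = (\<lambda>z. J (cut g) z + J (cut h) z)"
    using J g h by (simp add: hardy_ops_def eigen_def)
  ultimately show ?thesis
    using g h m by (simp add: eigen_def distrib_left)
qed

text \<open>
  Boundedness makes sums integrable over the circle.
\<close>
definition eigen_bounded :: "(complex \<Rightarrow> complex) \<Rightarrow> bool" where
  "eigen_bounded h \<longleftrightarrow> eigen h \<and> bounded (h ` cball 0 1)"

lemma eigen_bounded_add: "eigen_bounded g \<Longrightarrow> eigen_bounded h \<Longrightarrow> eigen_bounded (\<lambda>z. g z + h z)"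
  unfolding eigen_bounded_def by (intro conjI eigen_add bounded_plus_comp) auto

lemma eigen_bounded_cmult: "eigen_bounded h \<Longrightarrow> eigen_bounded (\<lambda>z. b * h z)"
  unfolding eigen_bounded_def
proof (intro conjI eigen_cmult)
  assume "eigen h \<and> bounded (h ` cball 0 1)"
  then obtain B where "\<And>z. z \<in> cball 0 1 \<Longrightarrow> cmod (h z) \<le> B" unfolding bounded_iff by blast
  then show "bounded ((\<lambda>z. b * h z) ` cball 0 1)"
    by (intro boundedI[of _ "cmod b * B"]) (auto simp: norm_mult intro!: mult_left_mono)
qed auto

lemma eigen_bounded_sum:
  assumes "finite A" "A \<noteq> {}" "\<And>k. k \<in> A \<Longrightarrow> eigen_bounded (f k)"
  shows "eigen_bounded (\<lambda>z. \<Sum>k\<in>A. f k z)"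
  using assms by (induction A rule: finite_ne_induct) (auto intro: eigen_bounded_add)

lemma inner_exp_add: "inner_exp s z * inner_exp t z = inner_exp (s + t) z"
  by (simp add: inner_exp_def distrib_right flip: exp_add)

lemma inner_exp_0: "inner_exp 0 = (\<lambda>z. 1)"
  by (simp add: inner_exp_def fun_eq_iff)

text \<open>
  The function \<open>1 / (1 + w)\<close> in half-plane coordinates, the Laplace transform of the eigenfunctions at
  \<open>1\<close>.
\<close>
definition resolvent :: "complex \<Rightarrow> complex" where
  "resolvent z = (\<alpha> - z) / (2 * \<alpha>)"

lemma norm_resolvent_le: "z \<in> cball 0 1 \<Longrightarrow> cmod (resolvent z) \<le> 1"
  using norm_triangle_ineq4[of \<alpha> z] norm_\<alpha> by (simp add: resolvent_def norm_divide norm_mult)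

lemma resolvent_eq: "z \<noteq> \<alpha> \<Longrightarrow> resolvent z = 1 / (1 + cayley z)"
  using cayley_plus_1[of z] \<alpha>_nz by (simp add: resolvent_def add.commute)

definition laplace_sum :: "nat \<Rightarrow> complex \<Rightarrow> complex" where
  "laplace_sum n z = (\<Sum>k<(Suc n)\<^sup>2. of_real (exp (- (real k / real (Suc n))) / real (Suc n))
     * inner_exp (real k / real (Suc n)) z)"

lemma laplace_sum_eq:
  "laplace_sum n z = of_real (1 / real (Suc n)) *
     (\<Sum>k<(Suc n)\<^sup>2. exp (- (1 + cayley z) / of_real (real (Suc n))) ^ k)"
proof -
  have "of_real (exp (- (real k / N)) / N) * inner_exp (real k / N) z
      = of_real (1 / N) * exp (- (1 + cayley z) / of_real N) ^ k" for N k
  proof -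
    have "exp (- (1 + cayley z) / of_real N) ^ k = exp (of_nat k * (- (1 + cayley z) / of_real N))"
      by (rule exp_of_nat_mult[symmetric])
    also have "of_nat k * (- (1 + cayley z) / of_real N)
        = of_real (- (real k / N)) + (- (of_real (real k / N) * cayley z))"
      by (simp add: add_divide_distrib diff_divide_distrib algebra_simps)
    finally have "exp (- (1 + cayley z) / of_real N) ^ k
        = of_real (exp (- (real k / N))) * inner_exp (real k / N) z"
      by (simp only: exp_add exp_of_real inner_exp_def)
    then show ?thesis by simp
  qed
  then show ?thesis by (simp only: laplace_sum_def sum_distrib_left)
qed

text \<open>
  Multiplication by \<open>resolvent\<close> is a bounded pointwise limit of multiplications by \<open>laplace_sum n\<close>, and
  these only shift the exponent \<open>s\<close> since \<open>inner_exp s * inner_exp t = inner_exp (s + t)\<close>. Therefore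
  the induction on \<open>m\<close> must be for all \<open>s\<close>.
\<close>
lemma eigen_bounded_exp_resolvent: "0 \<le> s \<Longrightarrow> eigen_bounded (\<lambda>z. inner_exp s z * resolvent z ^ m)"
proof (induction m arbitrary: s)
  case 0
  have "cmod (inner_exp s z) \<le> 1" if "z \<in> cball 0 1" for z
    by (rule norm_inner_exp_le[OF 0 that])
  then show ?case
    using eigen_inner_exp[OF 0] by (auto simp: eigen_bounded_def intro!: boundedI[of _ 1])
next
  case (Suc m)
  let ?h = "\<lambda>z. inner_exp s z * resolvent z ^ Suc m"
  let ?hs = "\<lambda>n z. laplace_sum n z * (inner_exp s z * resolvent z ^ m)"
  have le1: "cmod (inner_exp s z * resolvent z ^ m) \<le> 1" if "z \<in> cball 0 1" for z m
    using norm_inner_exp_le[OF Suc.prems that] norm_resolvent_le[OF that]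
    by (simp add: norm_mult norm_power mult_le_one power_le_one)
  have "eigen ?h"
  proof (rule eigen_bounded_convergence[where hs = ?hs and B = 2])
    fix n
    let ?N = "real (Suc n)"
    have "?hs n = (\<lambda>z. \<Sum>k<(Suc n)\<^sup>2. of_real (exp (- (real k / ?N)) / ?N)
        * (inner_exp (real k / ?N + s) z * resolvent z ^ m))"
      by (simp add: laplace_sum_def sum_distrib_right inner_exp_add[symmetric] mult.assoc)
    moreover have "eigen_bounded \<dots>"
      using Suc.prems by (intro eigen_bounded_sum eigen_bounded_cmult Suc.IH) (auto simp: lessThan_empty_iff)
    ultimately show "eigen (?hs n)" by (simp add: eigen_bounded_def)
  next
    show "?h holomorphic_on \<D>"
      unfolding resolvent_def using \<alpha>_nz norm_\<alpha>
      by (intro holomorphic_intros holomorphic_on_subset[OF inner_exp_holomorphic]) auto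
    show "continuous_on (cball 0 1 - {\<alpha>}) ?h"
      unfolding resolvent_def using \<alpha>_nz
      by (intro continuous_intros continuous_on_subset[OF holomorphic_on_imp_continuous_on[OF inner_exp_holomorphic]]) auto
  next
    fix n z assume z: "z \<in> cball 0 1 - {\<alpha>}"
    then have y: "1 \<le> Re (1 + cayley z)" using Re_cayley_nonneg[of z] by simp
    have "cmod (laplace_sum n z) \<le> 2"
      unfolding laplace_sum_eq by (rule geometric_laplace_bound[OF y]) simp
    moreover have "cmod (inner_exp s z * resolvent z ^ m) \<le> 1" using z by (intro le1) auto
    ultimately have "cmod (laplace_sum n z) * cmod (inner_exp s z * resolvent z ^ m) \<le> 2 * 1"
      by (intro mult_mono) auto
    then show "cmod (?hs n z) \<le> 2" by (simp only: norm_mult[of "laplace_sum n z"])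
  next
    fix z assume z: "z \<in> cball 0 1 - {\<alpha>}"
    then have y: "1 \<le> Re (1 + cayley z)" using Re_cayley_nonneg[of z] by simp
    have "(\<lambda>n. laplace_sum n z) \<longlonglongrightarrow> resolvent z"
      unfolding laplace_sum_eq using geometric_laplace_tendsto[OF y] z by (simp add: resolvent_eq)
    then have "(\<lambda>n. ?hs n z) \<longlonglongrightarrow> resolvent z * (inner_exp s z * resolvent z ^ m)"
      by (intro tendsto_intros)
    then show "(\<lambda>n. ?hs n z) \<longlonglongrightarrow> ?h z" by (simp add: mult_ac)
  qed
  then show ?case
    unfolding eigen_bounded_def using le1[of _ "Suc m"]
    by (intro conjI boundedI[of _ 1]) (auto simp del: power_Suc)
qed

text \<open>
  Since \<open>z = \<alpha> - 2 * \<alpha> * resolvent z\<close>, raising the power of \<open>z\<close> costs a power of \<open>resolvent\<close>, which the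
  induction leaves arbitrary.
\<close>
lemma eigen_bounded_monomial: "eigen_bounded (\<lambda>z. resolvent z ^ m * z ^ n)"
proof (induction n arbitrary: m)
  case 0
  then show ?case using eigen_bounded_exp_resolvent[of 0 m] by (simp add: inner_exp_0)
next
  case (Suc n)
  have z: "z = \<alpha> + (- 2 * \<alpha>) * resolvent z" for z
    using \<alpha>_nz by (simp add: resolvent_def)
  have "resolvent z ^ m * z ^ Suc n = \<alpha> * (resolvent z ^ m * z ^ n) + (- 2 * \<alpha>) * (resolvent z ^ Suc m * z ^ n)" for z
  proof -
    have "resolvent z ^ m * z ^ Suc n = resolvent z ^ m * z ^ n * z" by simp
    also have "\<dots> = resolvent z ^ m * z ^ n * (\<alpha> + (- 2 * \<alpha>) * resolvent z)" by (subst (3) z) simp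
    finally show ?thesis by (simp add: algebra_simps)
  qed
  then have "(\<lambda>z. resolvent z ^ m * z ^ Suc n)
      = (\<lambda>z. \<alpha> * (resolvent z ^ m * z ^ n) + (- 2 * \<alpha>) * (resolvent z ^ Suc m * z ^ n))"
    by (rule ext)
  moreover have "eigen_bounded \<dots>" by (intro eigen_bounded_add eigen_bounded_cmult Suc.IH)
  ultimately show ?case by simp
qed

text \<open>
  Taylor polynomials of a dilation converge boundedly on the closed disc, and so do the dilations of
  \<open>h\<close> as the radius tends to \<open>1\<close>.
\<close>
lemma eigen_of_bounded:
  assumes hol: "h holomorphic_on \<D>" and cont: "continuous_on (cball 0 1 - {\<alpha>}) h"
    and B: "\<And>z. z \<in> cball 0 1 - {\<alpha>} \<Longrightarrow> cmod (h z) \<le> B"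
  shows "eigen h"
proof (rule eigen_bounded_convergence[OF _ hol cont])
  fix n
  let ?r = "radius n"
  define b where "b k = (deriv ^^ k) h 0 / fact k" for k
  have sums: "(\<lambda>k. b k * w ^ k) sums h w" if "w \<in> \<D>" for w
    using holomorphic_power_series[OF hol that] by (simp add: b_def)
  have summ: "summable (\<lambda>k. norm (b k * of_real ?r ^ k))"
  proof (rule powser_insidea[of b "of_real ((1 + ?r) / 2)"])
    show "summable (\<lambda>k. b k * of_real ((1 + ?r) / 2) ^ k)"
      using radius_bounds[of n] by (intro sums_summable[OF sums]) (simp del: of_real_divide of_real_add)
    show "cmod (of_real ?r) < cmod (of_real ((1 + ?r) / 2))"
      using radius_bounds[of n] by (simp del: of_real_divide of_real_add)
  qed
  show "eigen (\<lambda>z. h (of_real ?r * z))"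
  proof (rule eigen_bounded_convergence)
    fix m
    have "eigen_bounded (\<lambda>z. \<Sum>k<Suc m. (b k * of_real ?r ^ k) * (resolvent z ^ 0 * z ^ k))"
      by (intro eigen_bounded_sum eigen_bounded_cmult eigen_bounded_monomial) auto
    then show "eigen (\<lambda>z. \<Sum>k<Suc m. (b k * of_real ?r ^ k) * (resolvent z ^ 0 * z ^ k))"
      by (simp add: eigen_bounded_def)
  next
    show "(\<lambda>z. h (of_real ?r * z)) holomorphic_on \<D>" by (rule dilate_holomorphic[OF hol])
    show "continuous_on (cball 0 1 - {\<alpha>}) (\<lambda>z. h (of_real ?r * z))"
      by (rule continuous_on_subset[OF dilate_continuous[OF hol]]) auto
  next
    fix m z assume "z \<in> cball 0 1 - {\<alpha>}"
    then have z: "cmod z \<le> 1" by simp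
    have "cmod (\<Sum>k<Suc m. (b k * of_real ?r ^ k) * (resolvent z ^ 0 * z ^ k))
        \<le> (\<Sum>k<Suc m. norm (b k * of_real ?r ^ k))"
      by (rule order_trans[OF norm_sum], intro sum_mono)
         (simp add: norm_mult norm_power mult_left_le power_le_one z)
    also have "\<dots> \<le> (\<Sum>k. norm (b k * of_real ?r ^ k))"
      by (rule sum_le_suminf[OF summ]) auto
    finally show "cmod (\<Sum>k<Suc m. (b k * of_real ?r ^ k) * (resolvent z ^ 0 * z ^ k))
        \<le> (\<Sum>k. norm (b k * of_real ?r ^ k))" .
  next
    fix z assume z: "z \<in> cball 0 1 - {\<alpha>}"
    have "(\<lambda>k. b k * (of_real ?r * z) ^ k) sums h (of_real ?r * z)"
      using z by (intro sums radius_cball) auto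
    then have "(\<lambda>m. \<Sum>k<m. b k * (of_real ?r * z) ^ k) \<longlonglongrightarrow> h (of_real ?r * z)"
      by (simp add: sums_def)
    then have "(\<lambda>m. \<Sum>k<Suc m. b k * (of_real ?r * z) ^ k) \<longlonglongrightarrow> h (of_real ?r * z)"
      by (rule LIMSEQ_Suc)
    then show "(\<lambda>m. \<Sum>k<Suc m. (b k * of_real ?r ^ k) * (resolvent z ^ 0 * z ^ k)) \<longlonglongrightarrow> h (of_real ?r * z)"
      by (simp add: power_mult_distrib mult.assoc)
  qed
next
  fix n z assume "z \<in> cball 0 1 - {\<alpha>}"
  then have "of_real (radius n) * z \<in> \<D>" by (intro radius_cball) auto
  then show "cmod (h (of_real (radius n) * z)) \<le> B"
    using disc_ne_\<alpha> by (intro B) auto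
next
  fix z assume z: "z \<in> cball 0 1 - {\<alpha>}"
  show "(\<lambda>n. h (of_real (radius n) * z)) \<longlonglongrightarrow> h z"
    by (rule radial_limit[OF cont z])
qed

text \<open>
  The distance of \<open>par z\<close> from the circle is at least of order \<open>(cmod (\<alpha> - z))\<^sup>2\<close>, so \<open>f \<circ> par\<close> is mild; it is integrable on the circle by Fatou's lemma. Its products with
  \<open>damp n ^ 2\<close> are bounded and are dominated by \<open>f \<circ> par\<close> itself.
\<close>
lemma eigen_comp_par:
  assumes f: "f \<in> hardy_space p"
  shows "eigen (\<lambda>z. f (par z))"
proof -
  define G where "G = (\<lambda>z. f (par z))"
  let ?S = "hardy_sup p f"
  have hol: "f holomorphic_on \<D>" using f by (simp add: hardy_space_def)
  have S: "0 \<le> ?S" by (rule hardy_sup_nonneg[OF f])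
  have G_hol: "G holomorphic_on \<D>"
    using holomorphic_on_compose_gen[OF par_holomorphic hol par_image] by (simp add: G_def o_def)
  have G_cont: "continuous_on (cball 0 1 - {\<alpha>}) G"
    unfolding G_def
    by (rule continuous_on_compose2[OF holomorphic_on_imp_continuous_on[OF hol] par_continuous])
       (use par_disc in blast)
  define C where "C = 4 + ?S * (2 + 2 * cmod a)\<^sup>2 / (2 * Re a)"
  have G_bound: "cmod (G z) * (cmod (\<alpha> - z))\<^sup>2 \<le> C" if z: "z \<in> cball 0 1 - {\<alpha>}" for z
  proof -
    let ?d = "cmod (\<alpha> - z)" and ?v = "cayley z + a"
    have d: "?d \<le> 2" using norm_triangle_ineq4[of \<alpha> z] z norm_\<alpha> by simp
    have "cmod (G z) \<le> 1 + ?S * (cmod (?v + 1))\<^sup>2 / (2 * Re a)"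
      unfolding G_def par_def using Re_a Re_cayley_nonneg[of z] z by (intro hardy_growth f) auto
    then have "cmod (G z) * ?d\<^sup>2 \<le> (1 + ?S * (cmod (?v + 1))\<^sup>2 / (2 * Re a)) * ?d\<^sup>2"
      by (intro mult_right_mono) auto
    then have le: "cmod (G z) * ?d\<^sup>2 \<le> ?d\<^sup>2 + ?S * (cmod (?v + 1) * ?d)\<^sup>2 / (2 * Re a)"
      by (simp add: distrib_right power_mult_distrib)
    have "(?v + 1) * (\<alpha> - z) = (cayley z + 1) * (\<alpha> - z) + a * (\<alpha> - z)"
      by (simp add: algebra_simps)
    also have "\<dots> = 2 * \<alpha> + a * (\<alpha> - z)"
      using z cayley_plus_1[of z] by (simp add: eq_commute[of \<alpha> z])
    finally have "cmod (?v + 1) * ?d = cmod (2 * \<alpha> + a * (\<alpha> - z))"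
      by (simp only: norm_mult[symmetric])
    also have "\<dots> \<le> 2 + cmod a * ?d"
      by (rule order_trans[OF norm_triangle_ineq]) (simp add: norm_mult norm_\<alpha>)
    also have "\<dots> \<le> 2 + 2 * cmod a"
      using mult_left_mono[OF d, of "cmod a"] by simp
    finally have "?S * (cmod (?v + 1) * ?d)\<^sup>2 / (2 * Re a) \<le> ?S * (2 + 2 * cmod a)\<^sup>2 / (2 * Re a)"
      using S Re_a by (intro divide_right_mono mult_left_mono power_mono) auto
    moreover have "?d\<^sup>2 \<le> 4" using power_mono[OF d, of 2] by simp
    ultimately show ?thesis using le by (simp add: C_def)
  qed
  have G_mild: "mild G" unfolding mild_def using G_hol G_cont G_bound by blast
  have fin: "circ_pow G < \<infinity>"
  proof -
    let ?B = "ennreal (hardy_sup p (comp_op par f))"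
    have cf: "comp_op par f \<in> hardy_space p"
      by (rule comp_op_bounded(1)[OF par_holomorphic par_image f])
    have "circ_pow G \<le> ?B"
      unfolding circ_pow_def
    proof (rule nn_integral_limit_bound)
      fix n
      have "continuous_on punct (\<lambda>t. G (of_real (radius n) * cis t))"
        by (rule continuous_on_compose2[OF dilate_continuous[OF G_hol]])
           (auto intro!: continuous_intros)
      then have [measurable]: "(\<lambda>t. G (of_real (radius n) * cis t)) \<in> borel_measurable circ"
        by (rule measurable_circ)
      show "(\<lambda>t. ennreal (cmod (G (of_real (radius n) * cis t)) powr p)) \<in> borel_measurable circ"
        by measurable
      have "(\<integral>\<^sup>+t. ennreal (cmod (G (of_real (radius n) * cis t)) powr p) \<partial>circ)
          = ennreal (hardy_integral p G (radius n))"
        using radius_bounds[of n]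
        by (intro pow_mean_circ holomorphic_on_imp_continuous_on[OF G_hol]) auto
      also have "hardy_integral p G (radius n) = hardy_integral p (comp_op par f) (radius n)"
        using radius_bounds[of n] by (simp add: hardy_integral_def G_def comp_op_def norm_mult)
      also have "ennreal \<dots> \<le> ?B"
        by (intro ennreal_leI hardy_integral_le_sup cf radius_bounds)
      finally show "(\<integral>\<^sup>+t. ennreal (cmod (G (of_real (radius n) * cis t)) powr p) \<partial>circ) \<le> ?B" .
    next
      fix t assume "t \<in> space circ"
      then have "cis t \<in> cball 0 1 - {\<alpha>}" by (intro punct_cis) (simp add: space_circ)
      from radial_limit[OF G_cont this]
      show "(\<lambda>n. ennreal (cmod (G (of_real (radius n) * cis t)) powr p)) \<longlonglongrightarrow> ennreal (cmod (G (cis t)) powr p)"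
        using p by (intro tendsto_ennrealI tendsto_powr' tendsto_norm tendsto_const) auto
    qed
    then show ?thesis by (rule le_less_trans) simp
  qed
  have "eigen G"
  proof (rule eigen_dominated_convergence[of "\<lambda>n z. G z * damp n z ^ 2" _ "\<lambda>t. cmod (G (cis t))"])
    fix n
    show "eigen (\<lambda>z. G z * damp n z ^ 2)"
    proof (rule eigen_of_bounded)
      show "(\<lambda>z. G z * damp n z ^ 2) holomorphic_on \<D>"
        by (intro holomorphic_intros G_hol damp_holomorphic)
      show "continuous_on (cball 0 1 - {\<alpha>}) (\<lambda>z. G z * damp n z ^ 2)"
        by (intro continuous_intros G_cont continuous_on_subset[OF damp_continuous]) auto
      fix z assume z: "z \<in> cball 0 1 - {\<alpha>}"
      have "cmod (damp n z) ^ 2 \<le> (real (Suc n) * cmod (\<alpha> - z)) ^ 2"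
        using z by (intro power_mono norm_damp_le) auto
      then have "cmod (G z * damp n z ^ 2) \<le> cmod (G z) * (real (Suc n) * cmod (\<alpha> - z)) ^ 2"
        by (simp add: norm_mult norm_power mult_left_mono del: of_nat_Suc)
      also have "\<dots> = (real (Suc n))\<^sup>2 * (cmod (G z) * (cmod (\<alpha> - z))\<^sup>2)"
        by (simp add: power_mult_distrib del: of_nat_Suc)
      also have "\<dots> \<le> (real (Suc n))\<^sup>2 * C"
        by (intro mult_left_mono G_bound z) auto
      finally show "cmod (G z * damp n z ^ 2) \<le> (real (Suc n))\<^sup>2 * C" .
    qed
  next
    show "mild G" by (rule G_mild)
    have [measurable]: "(\<lambda>t. G (cis t)) \<in> borel_measurable circ"
      by (rule measurable_circ_boundary[OF G_cont])
    show "(\<lambda>t. cmod (G (cis t))) \<in> borel_measurable circ" by measurable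
    show "(\<integral>\<^sup>+t. ennreal (cmod (G (cis t)) powr p) \<partial>circ) < \<infinity>"
      using fin by (simp add: circ_pow_def)
    show "cmod (G (cis t) * damp n (cis t) ^ 2) \<le> cmod (G (cis t))" for n t
      using norm_damp_le_1[of "cis t" n] by (simp add: norm_mult norm_power power_le_one mult_left_le)
    fix z assume z: "z \<in> cball 0 1 - {\<alpha>}"
    then have "(\<lambda>n. G z * damp n z ^ 2) \<longlonglongrightarrow> G z * 1 ^ 2"
      by (intro tendsto_intros damp_tendsto) auto
    then show "(\<lambda>n. G z * damp n z ^ 2) \<longlonglongrightarrow> G z" by simp
  qed
  then show ?thesis by (simp add: G_def)
qed

text \<open>
  As \<open>J\<close> commutes with the composition operator, \<open>J f\<close> and \<open>c * f\<close> agree on the image of \<open>par\<close>. In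
  half-plane coordinates this image is \<open>Re w > Re a\<close>, a non-empty open set.
\<close>
lemma scalar_action:
  assumes comm: "ops_commute p (comp_op par) J" and f: "f \<in> hardy_space p"
  shows "J f = (\<lambda>z. c * f z)"
proof -
  have Jf: "J f \<in> hardy_space p" using J f by (simp add: hardy_ops_def)
  have hol: "f holomorphic_on \<D>" "J f holomorphic_on \<D>"
    using f Jf by (auto simp: hardy_space_def)
  have on_image: "J f (par z) = c * f (par z)" if z: "z \<in> \<D>" for z
  proof -
    have "cut (\<lambda>z. f (par z)) = comp_op par f" by (simp add: cut_def comp_op_def)
    moreover have "comp_op par (J f) = J (comp_op par f)"
      using comm f by (simp add: ops_commute_def)
    ultimately have "comp_op par (J f) z = c * f (par z)"
      using eigen_comp_par[OF f] z by (simp add: eigen_def)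
    then show ?thesis using z by (simp add: comp_op_def)
  qed
  define S where "S = \<D> \<inter> cayley -` {w. Re a < Re w}"
  have "open S"
  proof -
    have "continuous_on \<D> cayley"
      by (rule holomorphic_on_imp_continuous_on, rule holomorphic_on_subset[OF cayley_holomorphic])
         (use norm_\<alpha> in auto)
    from continuous_open_preimage[OF this open_ball open_halfspace_Re_gt]
    show ?thesis by (simp add: S_def)
  qed
  moreover have "S \<noteq> {}"
  proof -
    let ?w = "of_real (Re a + 1)"
    have "inv_cayley ?w \<in> \<D>" using Re_a by (intro inv_cayley_disc) auto
    moreover have "cayley (inv_cayley ?w) = ?w"
      using Re_a by (intro cayley_inv_cayley right_half_plane_ne) auto
    ultimately have "inv_cayley ?w \<in> S" by (simp add: S_def)
    then show ?thesis by blast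
  qed
  moreover have "J f z = c * f z" if "z \<in> S" for z
  proof -
    let ?y = "inv_cayley (cayley z - a)"
    have z: "z \<in> \<D>" "Re a < Re (cayley z)" using that by (auto simp: S_def)
    have "cayley ?y = cayley z - a"
      using z by (intro cayley_inv_cayley right_half_plane_ne) simp
    then have "par ?y = inv_cayley (cayley z)" by (simp add: par_def)
    then have "par ?y = z" using disc_ne_\<alpha>[OF z(1)] by (simp add: inv_cayley_cayley)
    moreover have "?y \<in> \<D>" using z by (intro inv_cayley_disc) auto
    ultimately show ?thesis using on_image[of ?y] by simp
  qed
  ultimately have on_disc: "J f z = c * f z" if "z \<in> \<D>" for z
    using that by (intro analytic_continuation_open[of S \<D> "J f" "\<lambda>z. c * f z" z] hol holomorphic_intros)
       (simp_all add: S_def)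
  show ?thesis
  proof
    fix z show "J f z = c * f z"
      using on_disc Jf f by (cases "z \<in> \<D>") (auto simp: hardy_space_def)
  qed
qed

end

section \<open>No non-trivial idempotent in the commutant\<close>

context parabolic_map
begin

text \<open>
  All eigenfunctions have a positive value at \<open>0\<close>, and there the scalar by which \<open>J\<close> acts on them can
  be compared for different exponents.
\<close>
lemma no_commuting_idempotent:
  assumes comm: "ops_commute p (comp_op par) J"
  shows "\<not> nontrivial_idempotent p J"
proof
  assume idem: "nontrivial_idempotent p J"
  then have J: "J \<in> hardy_ops p" and JJ: "\<And>f. f \<in> hardy_space p \<Longrightarrow> J (J f) = J f"
    by (auto simp: nontrivial_idempotent_def)
  have J_mem: "J f \<in> hardy_space p" and J_scale: "J (\<lambda>z. b * f z) = (\<lambda>z. b * J f z)"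
    if "f \<in> hardy_space p" for f b
    using J that by (auto simp: hardy_ops_def)
  let ?e = "\<lambda>s. cut (inner_exp s)"
  have "\<exists>b. J (?e s) = (\<lambda>z. b * ?e s z)" if s: "0 \<le> s" for s
  proof (rule eigenfunction[OF J_mem s])
    show e: "?e s \<in> hardy_space p" by (rule inner_exp_in_space[OF s])
    have "comp_op par (J (?e s)) = J (comp_op par (?e s))"
      using comm e by (simp add: ops_commute_def)
    then show "comp_op par (J (?e s)) = (\<lambda>z. exp (- (of_real s * a)) * J (?e s) z)"
      by (simp add: comp_op_inner_exp J_scale[OF e])
  qed
  then obtain b where b: "\<And>s. 0 \<le> s \<Longrightarrow> J (?e s) = (\<lambda>z. b s * ?e s z)" by metis
  have e0: "?e s 0 = of_real (exp (- s))" for s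
    using \<alpha>_nz by (simp add: cut_def inner_exp_def cayley_def exp_of_real flip: of_real_minus)
  have b01: "b s \<in> {0, 1}" if s: "0 \<le> s" for s
  proof -
    have e: "?e s \<in> hardy_space p" by (rule inner_exp_in_space[OF s])
    have "J (J (?e s)) = (\<lambda>z. b s * (b s * ?e s z))"
      by (simp add: b[OF s] J_scale[OF e])
    then have "b s * (b s * ?e s 0) = b s * ?e s 0"
      using JJ[OF e] b[OF s] by metis
    then show ?thesis by (simp add: e0)
  qed
  have "continuous_on {0..} b"
    unfolding continuous_on_sequentially
  proof (intro allI ballI impI)
    fix x :: "nat \<Rightarrow> real" and s :: real
    assume s: "s \<in> {0..}" and x: "(\<forall>n. x n \<in> {0..}) \<and> x \<longlonglongrightarrow> s"
    have "(\<lambda>n. J (?e (x n)) 0) \<longlonglongrightarrow> J (?e s) 0"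
    proof (rule hardy_op_dominated_convergence[OF J _ _ _ nn_integral_circ_const])
      show "mild (inner_exp (x n))" for n using x by (intro mild_inner_exp) auto
      show "mild (inner_exp s)" using s by (intro mild_inner_exp) auto
      show "(\<lambda>_. 1) \<in> borel_measurable circ" by simp
      show "cmod (inner_exp (x n) (cis t)) \<le> 1" for n t
        using x by (intro norm_inner_exp_le) auto
      show "(\<lambda>n. inner_exp (x n) (cis t)) \<longlonglongrightarrow> inner_exp s (cis t)" for t
        unfolding inner_exp_def using x by (intro tendsto_intros) auto
    qed simp
    then have "(\<lambda>n. b (x n) * of_real (exp (- x n))) \<longlonglongrightarrow> b s * of_real (exp (- s))"
      using x s b e0 by simp
    moreover have "(\<lambda>n. of_real (exp (- x n))) \<longlonglongrightarrow> (of_real (exp (- s)) :: complex)"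
      using x by (intro tendsto_intros) auto
    ultimately have "(\<lambda>n. b (x n) * of_real (exp (- x n)) / of_real (exp (- x n)))
        \<longlonglongrightarrow> b s * of_real (exp (- s)) / of_real (exp (- s))"
      by (rule tendsto_divide) simp
    then show "(b \<circ> x) \<longlonglongrightarrow> b s" by (simp add: o_def)
  qed
  moreover have "finite (b ` {0..})"
    by (rule finite_subset[of _ "{0, 1}"]) (use b01 in auto)
  moreover have "connected {0::real..}" by (intro convex_connected) simp
  ultimately have "b constant_on {0..}"
    using continuous_finite_range_constant by blast
  then obtain c where c: "\<And>s. 0 \<le> s \<Longrightarrow> b s = c" by (auto simp: constant_on_def)
  interpret scalar_on_exp \<alpha> p a J c
    by unfold_locales (auto simp: J b c)
  have "c = 0 \<or> c = 1" using b01[of 0] c[of 0] by auto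
  then show False
    using scalar_action[OF comm] idem by (auto simp: nontrivial_idempotent_def)
qed

end

section \<open>The normal form of a parabolic linear fractional self-map\<close>

text \<open>
  The fixed point is not at infinity, since translations do not map the disc into itself. Uniqueness
  makes \<open>\<alpha>\<close> a double root of the fixed point equation, and \<open>1 / (z - \<alpha>)\<close> is a coordinate in which the
  map is a translation. The point \<open>\<alpha> - 1 / k\<close> is its pole.
\<close>
lemma parabolic_normal_form:
  assumes par: "parabolic_linear_fractional \<phi>" and self: "\<phi> ` \<D> \<subseteq> \<D>"
  obtains \<alpha> k where "k \<noteq> 0"
    "\<And>z. z \<in> \<D> \<Longrightarrow> z \<noteq> \<alpha> \<Longrightarrow> \<phi> z \<noteq> \<alpha> \<and> 1 / (\<phi> z - \<alpha>) = 1 / (z - \<alpha>) + k"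
    "\<alpha> - 1 / k \<notin> \<D>"
proof -
  obtain M where M: "moebius_map M" "\<forall>z\<in>\<D>. M (Some z) = Some (\<phi> z)" "\<exists>!w. M w = w"
    using par unfolding parabolic_linear_fractional_def by (elim exE conjE) (rule that)
  obtain A B C D where det: "A * D - B * C \<noteq> 0" and M_eq: "M = moebius A B C D"
    using M(1) unfolding moebius_map_def by (elim exE conjE) (rule that)
  have \<phi>: "moebius A B C D (Some z) = Some (\<phi> z)" if "z \<in> \<D>" for z
    using M(2) that by (simp add: M_eq)
  have fixpt: "\<exists>!w. moebius A B C D w = w"
    using M(3) by (simp only: M_eq)
  have den: "C * z + D \<noteq> 0" and \<phi>_eq: "\<phi> z = (A * z + B) / (C * z + D)" if "z \<in> \<D>" for z
    using \<phi>[OF that] by (auto simp: moebius_def split: if_splits)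
  have C: "C \<noteq> 0"
  proof
    assume C0: "C = 0"
    then have AD: "A \<noteq> 0" "D \<noteq> 0" using det by auto
    have "moebius A B C D None = None" using C0 by (simp add: moebius_def)
    then have no_fin: "moebius A B C D (Some z) \<noteq> Some z" for z using fixpt by blast
    have AeqD: "A = D"
    proof (rule ccontr)
      assume "A \<noteq> D"
      then have "A * (B / (D - A)) + B = D * (B / (D - A))"
        by (simp add: field_simps)
      then have "moebius A B C D (Some (B / (D - A))) = Some (B / (D - A))"
        using C0 AD by (simp add: moebius_def)
      then show False using no_fin by blast
    qed
    have "B \<noteq> 0"
      using no_fin[of 0] C0 AD by (auto simp: moebius_def)
    define b where "b = B / D"
    have b: "b \<noteq> 0" using \<open>B \<noteq> 0\<close> AD by (simp add: b_def)
    have shift: "\<phi> z = z + b" if "z \<in> \<D>" for z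
      using \<phi>_eq[OF that] C0 AeqD AD by (simp add: b_def add_divide_distrib)
    have iter: "of_nat n * b \<in> \<D>" for n
    proof (induction n)
      case (Suc n)
      have "\<phi> (of_nat n * b) \<in> \<D>" using self Suc by blast
      then show ?case using shift[OF Suc] by (simp add: algebra_simps)
    qed simp
    obtain n where "1 / cmod b < real n" using reals_Archimedean2 by blast
    then have "1 < real n * cmod b" using b by (simp add: field_simps)
    then show False using iter[of n] by (simp add: norm_mult)
  qed
  then have "moebius A B C D None \<noteq> None" by (simp add: moebius_def)
  then obtain \<alpha> where \<alpha>: "moebius A B C D (Some \<alpha>) = Some \<alpha>"
    and uniq: "\<And>z. moebius A B C D (Some z) = Some z \<Longrightarrow> z = \<alpha>"
    using fixpt by (metis not_None_eq option.inject)
  have \<alpha>den: "C * \<alpha> + D \<noteq> 0" and \<alpha>fix: "A * \<alpha> + B = \<alpha> * (C * \<alpha> + D)"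
    using \<alpha> by (auto simp: moebius_def field_simps split: if_splits)
  \<comment> \<open>The other root of the fixed point equation, which has sum of roots \<open>(A - D) / C\<close>.\<close>
  define \<beta> where "\<beta> = (A - D) / C - \<alpha>"
  have sum: "A = D + C * (\<alpha> + \<beta>)" using C by (simp add: \<beta>_def field_simps)
  have prod: "B = - (C * \<alpha> * \<beta>)"
    using \<alpha>fix by (simp add: sum algebra_simps eq_neg_iff_add_eq_0)
  have det': "A * D - B * C = (C * \<alpha> + D) * (C * \<beta> + D)"
    by (simp add: sum prod algebra_simps)
  have "\<beta> = \<alpha>"
  proof (rule uniq)
    have "C * \<beta> + D \<noteq> 0" using det det' by auto
    moreover have "A * \<beta> + B = \<beta> * (C * \<beta> + D)" by (simp add: sum prod algebra_simps)
    ultimately show "moebius A B C D (Some \<beta>) = Some \<beta>" by (simp add: moebius_def)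
  qed
  define E where "E = C * \<alpha> + D"
  have E: "E \<noteq> 0" using \<alpha>den by (simp add: E_def)
  have AB: "A = E + C * \<alpha>" "B = - (C * \<alpha> * \<alpha>)" "D = E - C * \<alpha>"
    using sum prod \<open>\<beta> = \<alpha>\<close> by (auto simp: E_def algebra_simps)
  show ?thesis
  proof
    show "C / E \<noteq> 0" using C E by simp
    fix z assume z: "z \<in> \<D>" "z \<noteq> \<alpha>"
    have "\<phi> z - \<alpha> = E * (z - \<alpha>) / (C * z + D)"
      using \<phi>_eq[OF z(1)] den[OF z(1)] by (simp add: field_simps AB)
    then have inv: "1 / (\<phi> z - \<alpha>) = (C * z + D) / (E * (z - \<alpha>))" and "\<phi> z - \<alpha> \<noteq> 0"
      using E z den[OF z(1)] by auto
    moreover have "(C * z + D) / (E * (z - \<alpha>)) = 1 / (z - \<alpha>) + C / E"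
      using E z by (simp add: field_simps AB)
    ultimately show "\<phi> z \<noteq> \<alpha> \<and> 1 / (\<phi> z - \<alpha>) = 1 / (z - \<alpha>) + C / E" by auto
  next
    have "C * (\<alpha> - 1 / (C / E)) + D = 0" using C by (simp add: field_simps AB)
    then show "\<alpha> - 1 / (C / E) \<notin> \<D>" using den by blast
  qed
qed

lemma parabolic_fixed_point_on_circle:
  assumes self: "\<phi> ` \<D> \<subseteq> \<D>" and k: "k \<noteq> 0"
    and \<phi>: "\<And>z. z \<in> \<D> \<Longrightarrow> z \<noteq> \<alpha> \<Longrightarrow> \<phi> z \<noteq> \<alpha> \<and> 1 / (\<phi> z - \<alpha>) = 1 / (z - \<alpha>) + k"
    and pole: "\<alpha> - 1 / k \<notin> \<D>"
  shows "cmod \<alpha> = 1"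
proof (rule ccontr)
  assume "cmod \<alpha> \<noteq> 1"
  then consider "cmod \<alpha> < 1" | "1 < cmod \<alpha>" by linarith
  then show False
  proof cases
    case 1
    \<comment> \<open>The backward orbit of the pole accumulates at \<open>\<alpha>\<close>, hence meets the disc; from there \<open>\<phi>\<close>
      would lead to the pole without leaving the disc.\<close>
    define x where "x n = \<alpha> - 1 / (of_nat (Suc n) * k)" for n
    have x_notin: "x n \<notin> \<D>" for n
    proof (induction n)
      case 0
      then show ?case using pole by (simp add: x_def)
    next
      case (Suc n)
      show ?case
      proof
        assume D: "x (Suc n) \<in> \<D>"
        have ne: "x (Suc n) \<noteq> \<alpha>" using k by (simp add: x_def del: of_nat_Suc)
        have "1 / (x (Suc n) - \<alpha>) = - (of_nat (Suc (Suc n)) * k)" by (simp add: x_def del: of_nat_Suc)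
        then have "1 / (\<phi> (x (Suc n)) - \<alpha>) = - (of_nat (Suc n) * k)"
          using \<phi>[OF D ne] by (simp add: algebra_simps)
        then have "\<phi> (x (Suc n)) - \<alpha> = 1 / (- (of_nat (Suc n) * k))"
          by (metis divide_divide_eq_right mult_1 div_by_1)
        then have "\<phi> (x (Suc n)) = x n" by (simp add: x_def algebra_simps del: of_nat_Suc)
        moreover have "\<phi> (x (Suc n)) \<in> \<D>" using self D by blast
        ultimately show False using Suc by simp
      qed
    qed
    obtain n where n: "1 / ((1 - cmod \<alpha>) * cmod k) < real n" using reals_Archimedean2 by blast
    have "0 < (1 - cmod \<alpha>) * cmod k" using 1 k by simp
    from n[unfolded pos_divide_less_eq[OF this]]
    have "1 < real n * ((1 - cmod \<alpha>) * cmod k)" .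
    also have "\<dots> \<le> real (Suc n) * ((1 - cmod \<alpha>) * cmod k)"
      using 1 by (intro mult_right_mono) auto
    finally have "1 < (1 - cmod \<alpha>) * (real (Suc n) * cmod k)"
      by (simp only: mult.left_commute)
    then have "1 / (real (Suc n) * cmod k) < 1 - cmod \<alpha>"
      using k by (simp add: pos_divide_less_eq del: of_nat_Suc)
    then have "cmod (x n) < 1"
      using norm_triangle_ineq4[of \<alpha> "1 / (of_nat (Suc n) * k)"]
      by (simp add: x_def norm_divide norm_mult del: of_nat_Suc)
    then show False using x_notin[of n] by simp
  next
    case 2
    \<comment> \<open>The coordinate \<open>1 / (z - \<alpha>)\<close> is bounded on the disc, but not along the orbit of \<open>0\<close>.\<close>
    define x where "x n = (\<phi> ^^ n) 0" for n
    have ne: "z \<noteq> \<alpha>" if "z \<in> \<D>" for z using that 2 by auto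
    have xD: "x n \<in> \<D>" for n
    proof (induction n)
      case (Suc n)
      then have "\<phi> (x n) \<in> \<D>" using self by blast
      then show ?case by (simp add: x_def)
    qed (simp add: x_def)
    have inv: "1 / (x n - \<alpha>) = of_nat n * k - 1 / \<alpha>" for n
    proof (induction n)
      case (Suc n)
      have "1 / (x (Suc n) - \<alpha>) = 1 / (x n - \<alpha>) + k"
        using \<phi>[OF xD[of n] ne[OF xD[of n]]] by (simp add: x_def)
      then show ?case using Suc by (simp add: algebra_simps)
    qed (simp add: x_def)
    have bound: "cmod (1 / (x n - \<alpha>)) \<le> 1 / (cmod \<alpha> - 1)" for n
    proof -
      have "cmod \<alpha> - 1 \<le> cmod (x n - \<alpha>)"
        using norm_triangle_ineq2[of \<alpha> "x n"] xD[of n] by (simp add: norm_minus_commute)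
      then show ?thesis using 2 by (simp add: norm_divide frac_le)
    qed
    obtain n where "(1 / (cmod \<alpha> - 1) + cmod (1 / \<alpha>)) / cmod k < real n"
      using reals_Archimedean2 by blast
    then have "1 / (cmod \<alpha> - 1) + cmod (1 / \<alpha>) < cmod (of_nat n * k)"
      using k by (simp add: pos_divide_less_eq norm_mult)
    also have "\<dots> \<le> cmod (of_nat n * k - 1 / \<alpha>) + cmod (1 / \<alpha>)"
      using norm_triangle_ineq[of "of_nat n * k - 1 / \<alpha>" "1 / \<alpha>"] by simp
    finally show False using bound[of n] inv[of n] by simp
  qed
qed

theorem corollary4p9:
  fixes \<phi> :: "complex \<Rightarrow> complex" and p :: real
  assumes "1 \<le> p"
    and "parabolic_linear_fractional \<phi>"
    and "\<phi> ` \<D> \<subseteq> \<D>"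
    and "\<phi> ` \<D> \<noteq> \<D>"
  shows "comp_op \<phi> \<in> hardy_ops p \<and>
    \<not> (\<exists>J. nontrivial_idempotent p J \<and> ops_commute p (comp_op \<phi>) J)"
proof -
  obtain \<alpha> k where k: "k \<noteq> 0"
    and \<phi>: "\<And>z. z \<in> \<D> \<Longrightarrow> z \<noteq> \<alpha> \<Longrightarrow> \<phi> z \<noteq> \<alpha> \<and> 1 / (\<phi> z - \<alpha>) = 1 / (z - \<alpha>) + k"
    and pole: "\<alpha> - 1 / k \<notin> \<D>"
    by (rule parabolic_normal_form[OF assms(2,3)]) (rule that; blast)
  have "cmod \<alpha> = 1"
    by (rule parabolic_fixed_point_on_circle[OF assms(3) k \<phi> pole])
  then interpret punctured_circle \<alpha> p
    using assms(1) by unfold_locales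
  define a where "a = - 2 * \<alpha> * k"
  have cay: "cayley (\<phi> z) = cayley z + a" if z: "z \<in> \<D>" for z
  proof -
    have c: "cayley y = - 2 * \<alpha> * (1 / (y - \<alpha>)) - 1" if "y \<in> \<D>" for y
      using cayley_plus_1[OF disc_ne_\<alpha>[OF that]] disc_ne_\<alpha>[OF that] by (simp add: field_simps)
    have "\<phi> z \<in> \<D>" using assms(3) z by blast
    then have "cayley (\<phi> z) = - 2 * \<alpha> * (1 / (z - \<alpha>) + k) - 1"
      using \<phi>[OF z disc_ne_\<alpha>[OF z]] by (simp only: c)
    also have "\<dots> = (- 2 * \<alpha> * (1 / (z - \<alpha>)) - 1) + a"
      by (simp add: a_def distrib_left del: mult_minus_left mult_minus_right)
    finally show ?thesis by (simp only: c[OF z])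
  qed
  have \<phi>_inv: "\<phi> z = inv_cayley (cayley z + a)" if z: "z \<in> \<D>" for z
  proof -
    have "\<phi> z \<in> \<D>" using assms(3) z by blast
    then show ?thesis using cay[OF z] disc_ne_\<alpha> inv_cayley_cayley by metis
  qed
  have "0 < Re a"
  proof (rule ccontr)
    assume "\<not> 0 < Re a"
    then consider "Re a < 0" | "Re a = 0" by linarith
    then show False
    proof cases
      case 1
      \<comment> \<open>This point of the half-plane is translated onto the imaginary axis.\<close>
      let ?w = "of_real (- Re a)"
      have z: "inv_cayley ?w \<in> \<D>" using 1 by (intro inv_cayley_disc) auto
      have "cayley (\<phi> (inv_cayley ?w)) = ?w + a"
        using cay[OF z] 1 by (subst (asm) cayley_inv_cayley) (auto intro!: right_half_plane_ne)
      moreover have "\<phi> (inv_cayley ?w) \<in> \<D>" using assms(3) z by blast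
      ultimately show False using Re_cayley_pos by fastforce
    next
      case 2
      have "\<D> \<subseteq> \<phi> ` \<D>"
      proof
        fix y assume y: "y \<in> \<D>"
        let ?w = "cayley y - a"
        have w: "0 < Re ?w" using Re_cayley_pos[OF y] 2 by simp
        have z: "inv_cayley ?w \<in> \<D>" by (rule inv_cayley_disc[OF w])
        have "cayley (inv_cayley ?w) = ?w"
          using w by (intro cayley_inv_cayley right_half_plane_ne) auto
        then have "\<phi> (inv_cayley ?w) = inv_cayley (cayley y)"
          using \<phi>_inv[OF z] by simp
        then have "y = \<phi> (inv_cayley ?w)"
          using disc_ne_\<alpha>[OF y] by (simp add: inv_cayley_cayley)
        then show "y \<in> \<phi> ` \<D>" using z by (rule image_eqI)
      qed
      then show False using assms(3,4) by blast
    qed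
  qed
  then interpret parabolic_map \<alpha> p a
    by unfold_locales
  have "comp_op \<phi> f = comp_op par f" for f
    using \<phi>_inv by (auto simp: comp_op_def par_def)
  then have "comp_op \<phi> = comp_op par" by (rule ext)
  then show ?thesis
    using comp_op_in_hardy_ops[OF par_holomorphic par_image] no_commuting_idempotent by auto
qed

end
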